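(* The set of computable real numbers in $[0,1]$ which are absolutely normal is dense in $[0,1]$.
   Context: A real $x$ is computable if there is an algorithm (recursive function) $\mathcal A:\mathbb N\to\mathbb Q$ with $|\mathcal A(n)-x|\le 2^{-n}$ for all $n$. A real number $r\in[0,1]$ is absolutely normal if for every integer $b\ge2$ and every finite word $w$ over the alphabet $\{0,\dots,b-1\}$, the $b$-ary expansion $r_b\in\{0,\dots,b-1\}^{\mathbb N}$ of $r$ satisfies $\lim_{n\to\infty}\frac1n\#\{0\le i<n: w\text{ occurs in }r_b\text{ starting at position }i\}=b^{-|w|}$, where $|w|$ is the length of $w$. *)

theory Defs
  imports "HOL-Analysis.Analysis" "HOL-Library.Countable"
begin

text \<open>
  The general recursive functions (in Kleene's sense). \<open>recursive_fun k f\<close> says that the function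
  on \<open>k\<close>-tuples of natural numbers given by the restriction of \<open>f\<close> to lists of length \<open>k\<close> is recursive.
  By rule \<open>cong\<close>, the values of \<open>f\<close> on lists of any other length are irrelevant. Minimization
  is applied to regular functions only, so that all functions in the class are total.
\<close>

inductive recursive_fun :: "nat \<Rightarrow> (nat list \<Rightarrow> nat) \<Rightarrow> bool" where
  zero: "recursive_fun k (\<lambda>xs. 0)"
| succ: "recursive_fun 1 (\<lambda>xs. Suc (hd xs))"
| proj: "i < k \<Longrightarrow> recursive_fun k (\<lambda>xs. xs ! i)"
| comp: "recursive_fun (length gs) f \<Longrightarrow> (\<forall>g \<in> set gs. recursive_fun k g) \<Longrightarrow>
    recursive_fun k (\<lambda>xs. f (map (\<lambda>g. g xs) gs))"
| prim_rec: "recursive_fun k f \<Longrightarrow> recursive_fun (Suc (Suc k)) g \<Longrightarrow>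
    recursive_fun (Suc k) (\<lambda>xs. rec_nat (f (tl xs)) (\<lambda>n r. g (n # r # tl xs)) (hd xs))"
| minimize: "recursive_fun (Suc k) f \<Longrightarrow> (\<forall>xs. length xs = k \<longrightarrow> (\<exists>n. f (n # xs) = 0)) \<Longrightarrow>
    recursive_fun k (\<lambda>xs. LEAST n. f (n # xs) = 0)"
| cong: "recursive_fun k f \<Longrightarrow> (\<forall>xs. length xs = k \<longrightarrow> g xs = f xs) \<Longrightarrow> recursive_fun k g"

text \<open>
  Rationals are coded by naturals through the effective library enumeration
  \<open>nat_to_rat_surj\<close>, which decodes a natural number to a pair of naturals, and these
  to an integer numerator and denominator (denominator \<open>0\<close> giving the rational \<open>0\<close>).
\<close>

definition recursive_nat_rat :: "(nat \<Rightarrow> rat) \<Rightarrow> bool" where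
  "recursive_nat_rat A \<longleftrightarrow>
    (\<exists>f. recursive_fun 1 f \<and> (\<forall>n. A n = nat_to_rat_surj (f [n])))"

definition computable_real :: "real \<Rightarrow> bool" where
  "computable_real x \<longleftrightarrow>
    (\<exists>A :: nat \<Rightarrow> rat. recursive_nat_rat A \<and> (\<forall>n. \<bar>of_rat (A n) - x\<bar> \<le> 1 / 2 ^ n))"

text \<open>
  The digit at position \<open>i\<close> (counted from \<open>0\<close>) of the \<open>b\<close>-ary expansion of \<open>r\<close> in \<open>[0,1]\<close>. Of two
  expansions of a number below \<open>1\<close> the terminating one is taken; the only expansion of \<open>1\<close> of the
  form \<open>0.d\<^sub>0d\<^sub>1\<dots>\<close> has all digits \<open>b - 1\<close>.
\<close>

definition digit :: "nat \<Rightarrow> real \<Rightarrow> nat \<Rightarrow> nat" where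
  "digit b r i = (if r = 1 then b - 1 else nat \<lfloor>r * real b ^ Suc i\<rfloor> mod b)"

definition occurs_at :: "nat list \<Rightarrow> (nat \<Rightarrow> nat) \<Rightarrow> nat \<Rightarrow> bool" where
  "occurs_at w s i \<longleftrightarrow> (\<forall>j < length w. s (i + j) = w ! j)"

definition absolutely_normal :: "real \<Rightarrow> bool" where
  "absolutely_normal r \<longleftrightarrow> r \<in> {0..1} \<and>
    (\<forall>b :: nat. b \<ge> 2 \<longrightarrow> (\<forall>w :: nat list. set w \<subseteq> {..<b} \<longrightarrow>
      (\<lambda>n. real (card {i. i < n \<and> occurs_at w (digit b r) i}) / real n)
        \<longlonglongrightarrow> 1 / real b ^ length w))"

end

theory Submission
  imports Defs "HOL-Real_Asymp.Real_Asymp"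
begin

text \<open>
  The number is the intersection of nested intervals \<open>[a\<^sub>s / 2 ^ s ^ 8, (a\<^sub>s + 1) / 2 ^ s ^ 8]\<close>, where
  \<open>a\<^sub>s\<^sub>+\<^sub>1\<close> is found by a bounded search. Equidistribution of \<open>b ^ i * x\<close> modulo 1 is tested against
  tent functions: being Lipschitz, they make the sum over the block of those \<open>i\<close> with
  \<open>2 ^ s ^ 8 \<le> b ^ i < 2 ^ Suc s ^ 8\<close> almost constant on the next interval, so that a good left end point
  makes every point of the interval good, and the test only involves integers.

  The search succeeds because of a variance estimate. For a 1-periodic Lipschitz function \<open>\<phi>\<close> of
  mean zero the correlation of \<open>\<phi> u\<close> and \<open>\<phi> (B * u)\<close> is \<open>O(1 / B)\<close>, so the sum over a block with \<open>n\<close>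
  elements has mean square \<open>O(n)\<close> on any interval longer than the first period. The levels \<open>s ^ 8\<close> are
  chosen such that the blocks are long enough (about \<open>s ^ 7\<close>) for the errors \<open>s ^ 6\<close> to exceed the
  standard deviations of all \<open>s ^ 3\<close> tests with parameters below \<open>s\<close>, and short enough compared with
  \<open>s ^ 8\<close> for the averages to converge along all \<open>n\<close>, not only at the ends of blocks.

  Sums of tents approximate the indicator function of a cell from below. This bounds the lower
  frequency of each word from below by \<open>1 / b ^ l\<close>, which suffices, as the frequencies of the \<open>b ^ l\<close> words of
  length \<open>l\<close> add up to 1.
\<close>

section \<open>Closure properties of the recursive functions\<close>

section \<open>Recursive functions\<close>

lemma recursive_fun_comp1:
  assumes "recursive_fun 1 (\<lambda>xs. F (xs ! 0))" "recursive_fun k f"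
  shows "recursive_fun k (\<lambda>xs. F (f xs))"
  using recursive_fun.comp[of "[f]" "\<lambda>xs. F (xs ! 0)" k] assms by simp

lemma recursive_fun_comp2:
  assumes "recursive_fun 2 (\<lambda>xs. F (xs ! 0) (xs ! 1))" "recursive_fun k f" "recursive_fun k g"
  shows "recursive_fun k (\<lambda>xs. F (f xs) (g xs))"
  using recursive_fun.comp[of "[f, g]" "\<lambda>xs. F (xs ! 0) (xs ! 1)" k] assms
  by (simp add: numeral_2_eq_2)

lemma recursive_fun_Suc:
  assumes "recursive_fun k f"
  shows "recursive_fun k (\<lambda>xs. Suc (f xs))"
proof (rule recursive_fun_comp1[OF _ assms])
  show "recursive_fun 1 (\<lambda>xs. Suc (xs ! 0))"
    by (rule recursive_fun.cong[OF recursive_fun.succ]) (auto simp: length_Suc_conv)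
qed

lemma recursive_fun_const: "recursive_fun k (\<lambda>xs. c)"
  by (induction c) (auto intro: recursive_fun.zero recursive_fun_Suc)

lemma recursive_fun_hd: "0 < k \<Longrightarrow> recursive_fun k hd"
  by (rule recursive_fun.cong[OF recursive_fun.proj[of 0 k]]) (auto simp: hd_conv_nth)

text \<open>Argument lists serve as environments in the style of de Bruijn: in the body of a binder, \<open>hd xs\<close>
  is the bound variable and \<open>tl xs\<close> the outer environment, so the next lemma is weakening.\<close>

lemma recursive_fun_tl:
  assumes "recursive_fun k f"
  shows "recursive_fun (Suc k) (\<lambda>xs. f (tl xs))"
proof -
  have "recursive_fun (Suc k) (\<lambda>xs. f (map (\<lambda>g. g xs) (map (\<lambda>i xs. xs ! Suc i) [0..<k])))"
    using assms by (intro recursive_fun.comp) (auto intro: recursive_fun.proj)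
  then show ?thesis
    by (rule recursive_fun.cong) (auto simp: o_def nth_tl intro!: arg_cong[of _ _ f] nth_equalityI)
qed

text \<open>Primitive recursion runs on the head of the list and hides it from \<open>f\<close>.
  Composing with \<open>h\<close> followed by all projections keeps the whole environment available
  to the start value and to the step.\<close>

lemma recursive_fun_rec_nat:
  assumes f: "recursive_fun k f"
    and g: "recursive_fun (Suc (Suc k)) (\<lambda>xs. g (tl (tl xs)) (hd xs) (hd (tl xs)))"
    and h: "recursive_fun k h"
  shows "recursive_fun k (\<lambda>xs. rec_nat (f xs) (g xs) (h xs))"
proof -
  have "recursive_fun (Suc k) (\<lambda>xs. rec_nat (f (tl xs)) (\<lambda>n r. g (tl xs) n r) (hd xs))"
    using recursive_fun.prim_rec[OF f g] by simp
  then have "recursive_fun k (\<lambda>xs. (\<lambda>xs. rec_nat (f (tl xs)) (\<lambda>n r. g (tl xs) n r) (hd xs))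
      (map (\<lambda>g. g xs) (h # map (\<lambda>i xs. xs ! i) [0..<k])))"
    using h by (intro recursive_fun.comp) (auto intro: recursive_fun.proj)
  then show ?thesis
    by (rule recursive_fun.cong) (auto simp: o_def map_nth)
qed

lemma recursive_fun_add:
  assumes "recursive_fun k f" "recursive_fun k g"
  shows "recursive_fun k (\<lambda>xs. f xs + g xs)"
proof -
  have "rec_nat m (\<lambda>n. Suc) n = m + n" for m n by (induction n) auto
  moreover have "recursive_fun k (\<lambda>xs. rec_nat (f xs) ((\<lambda>xs n r. Suc r) xs) (g xs))"
    by (intro recursive_fun_rec_nat assms recursive_fun_Suc recursive_fun_tl[OF recursive_fun_hd]) simp
  ultimately show ?thesis by simp
qed

lemma recursive_fun_mult:
  assumes "recursive_fun k f" "recursive_fun k g"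
  shows "recursive_fun k (\<lambda>xs. f xs * g xs)"
proof -
  have "rec_nat 0 (\<lambda>n r. r + m) n = m * n" for m n :: nat by (induction n) auto
  moreover have "recursive_fun k (\<lambda>xs. rec_nat 0 ((\<lambda>xs n r. r + f xs) xs) (g xs))"
    by (intro recursive_fun_rec_nat recursive_fun_const recursive_fun_add recursive_fun_tl[OF recursive_fun_hd]
        recursive_fun_tl[OF recursive_fun_tl] assms) simp
  ultimately show ?thesis by simp
qed

lemma recursive_fun_power:
  assumes "recursive_fun k f" "recursive_fun k g"
  shows "recursive_fun k (\<lambda>xs. f xs ^ g xs)"
proof -
  have "rec_nat 1 (\<lambda>n r. r * m) n = m ^ n" for m n :: nat by (induction n) auto
  moreover have "recursive_fun k (\<lambda>xs. rec_nat 1 ((\<lambda>xs n r. r * f xs) xs) (g xs))"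
    by (intro recursive_fun_rec_nat recursive_fun_const recursive_fun_mult recursive_fun_tl[OF recursive_fun_hd]
        recursive_fun_tl[OF recursive_fun_tl] assms) simp
  ultimately show ?thesis by simp
qed

text \<open>Truncated subtraction iterates the predecessor, and the predecessor is the recursion
  that returns its own counter.\<close>

lemma recursive_fun_diff:
  assumes "recursive_fun k f" "recursive_fun k g"
  shows "recursive_fun k (\<lambda>xs. f xs - g xs)"
proof -
  have 1: "recursive_fun k (\<lambda>xs. f xs - 1)" if "recursive_fun k f" for k f
  proof -
    have "rec_nat 0 (\<lambda>n r. n) n = n - 1" for n by (induction n) auto
    moreover have "recursive_fun k (\<lambda>xs. rec_nat 0 ((\<lambda>xs n r. n) xs) (f xs))"
      by (intro recursive_fun_rec_nat recursive_fun_const recursive_fun_hd that) simp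
    ultimately show ?thesis by simp
  qed
  have "rec_nat m (\<lambda>n r. r - 1) n = m - n" for m n :: nat by (induction n) auto
  moreover have "recursive_fun k (\<lambda>xs. rec_nat (f xs) ((\<lambda>xs n r. r - 1) xs) (g xs))"
    by (intro recursive_fun_rec_nat 1 recursive_fun_tl[OF recursive_fun_hd] assms) simp
  ultimately show ?thesis by simp
qed

section \<open>Decidable predicates and bounded operators\<close>

definition recursive_pred :: "nat \<Rightarrow> (nat list \<Rightarrow> bool) \<Rightarrow> bool" where
  "recursive_pred k P \<longleftrightarrow> recursive_fun k (\<lambda>xs. of_bool (P xs))"

lemma recursive_pred_not:
  assumes "recursive_pred k P"
  shows "recursive_pred k (\<lambda>xs. \<not> P xs)"
  unfolding recursive_pred_def
  by (rule recursive_fun.cong[OF recursive_fun_diff[OF recursive_fun_const[of k 1]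
        assms[unfolded recursive_pred_def]]]) auto

lemma recursive_pred_conj:
  assumes "recursive_pred k P" "recursive_pred k Q"
  shows "recursive_pred k (\<lambda>xs. P xs \<and> Q xs)"
  using recursive_fun_mult[of k "\<lambda>xs. of_bool (P xs)" "\<lambda>xs. of_bool (Q xs)"] assms
  by (simp add: recursive_pred_def of_bool_conj)

lemma recursive_pred_imp:
  assumes "recursive_pred k P" "recursive_pred k Q"
  shows "recursive_pred k (\<lambda>xs. P xs \<longrightarrow> Q xs)"
  using recursive_pred_not[OF recursive_pred_conj[OF assms(1) recursive_pred_not[OF assms(2)]]] by simp

lemma recursive_pred_disj:
  assumes "recursive_pred k P" "recursive_pred k Q"
  shows "recursive_pred k (\<lambda>xs. P xs \<or> Q xs)"
  using recursive_pred_imp[OF recursive_pred_not[OF assms(1)] assms(2)] by (simp add: disj_imp)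

lemma recursive_pred_le:
  assumes "recursive_fun k f" "recursive_fun k g"
  shows "recursive_pred k (\<lambda>xs. f xs \<le> g xs)"
  unfolding recursive_pred_def
  \<comment> \<open>Subtraction truncates, so \<open>1 - (f xs - g xs)\<close> is the indicator of
    the comparison.\<close>
  by (rule recursive_fun.cong[OF recursive_fun_diff[OF recursive_fun_const[of k 1] recursive_fun_diff[OF assms]]])
    auto

lemma recursive_pred_less:
  assumes "recursive_fun k f" "recursive_fun k g"
  shows "recursive_pred k (\<lambda>xs. f xs < g xs)"
  using recursive_pred_le[OF recursive_fun_Suc[OF assms(1)] assms(2)] by (simp add: Suc_le_eq)

lemma recursive_pred_eq:
  assumes "recursive_fun k f" "recursive_fun k g"
  shows "recursive_pred k (\<lambda>xs. f xs = g xs)"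
  using recursive_pred_conj[OF recursive_pred_le[OF assms] recursive_pred_le[OF assms(2,1)]]
  by (simp add: eq_iff)

lemma recursive_fun_if:
  assumes "recursive_pred k P" "recursive_fun k f" "recursive_fun k g"
  shows "recursive_fun k (\<lambda>xs. if P xs then f xs else g xs)"
  by (rule recursive_fun.cong[OF recursive_fun_add[OF
        recursive_fun_mult[OF assms(1)[unfolded recursive_pred_def] assms(2)]
        recursive_fun_mult[OF recursive_pred_not[OF assms(1), unfolded recursive_pred_def] assms(3)]]])
    auto

lemma recursive_fun_mod:
  assumes "recursive_fun k f" "recursive_fun k g"
  shows "recursive_fun k (\<lambda>xs. f xs mod g xs)"
proof -
  \<comment> \<open>A counter that is reset on reaching \<open>m\<close>. For \<open>m = 0\<close>
    it is never reset, in agreement with \<open>n mod 0 = n\<close>.\<close>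
  have "rec_nat 0 (\<lambda>n r. if Suc r = m then 0 else Suc r) n = n mod m" for m n :: nat
    by (induction n) (auto simp: mod_Suc)
  moreover have "recursive_fun k (\<lambda>xs. rec_nat 0 ((\<lambda>xs n r. if Suc r = g xs then 0 else Suc r) xs) (f xs))"
    by (intro recursive_fun_rec_nat recursive_fun_if recursive_pred_eq recursive_fun_const
        recursive_fun_Suc recursive_fun_tl[OF recursive_fun_hd] recursive_fun_tl[OF recursive_fun_tl] assms) simp_all
  ultimately show ?thesis by simp
qed

lemma recursive_fun_sum:
  assumes f: "recursive_fun (Suc k) (\<lambda>xs. f (tl xs) (hd xs))" and g: "recursive_fun k g"
  shows "recursive_fun k (\<lambda>xs. \<Sum>i<g xs. f xs i)"
proof -
  have "rec_nat 0 (\<lambda>n r. r + h n) n = (\<Sum>i<n. h i)" for h :: "nat \<Rightarrow> nat" and n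
    by (induction n) auto
  moreover have "recursive_fun k (\<lambda>xs. rec_nat 0 ((\<lambda>xs n r. r + f xs n) xs) (g xs))"
  proof (intro recursive_fun_rec_nat recursive_fun_add recursive_fun_const recursive_fun_tl[OF recursive_fun_hd] g)
    \<comment> \<open>In the recursion step the accumulator stands between the index and the
      environment; the projections skip it.\<close>
    have "recursive_fun (Suc (Suc k)) (\<lambda>xs. (\<lambda>xs. f (tl xs) (hd xs))
        (map (\<lambda>g. g xs) (hd # map (\<lambda>i xs. xs ! Suc (Suc i)) [0..<k])))"
      using f by (intro recursive_fun.comp) (auto intro: recursive_fun.proj recursive_fun_hd)
    then show "recursive_fun (Suc (Suc k)) (\<lambda>xs. f (tl (tl xs)) (hd xs))"
      by (rule recursive_fun.cong)
        (auto simp: o_def nth_tl intro!: arg_cong2[of _ _ _ _ f] nth_equalityI)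
  qed simp
  ultimately show ?thesis by simp
qed

text \<open>The bounded quantifier is decided by counting counterexamples.\<close>

lemma recursive_pred_all_less:
  assumes "recursive_pred (Suc k) (\<lambda>xs. P (tl xs) (hd xs))" and "recursive_fun k g"
  shows "recursive_pred k (\<lambda>xs. \<forall>i<g xs. P xs i)"
proof -
  have "recursive_pred k (\<lambda>xs. (\<Sum>i<g xs. of_bool (\<not> P xs i)) = (0::nat))"
    using recursive_pred_not[OF assms(1)]
    by (intro recursive_pred_eq recursive_fun_sum recursive_fun_const assms(2))
      (simp add: recursive_pred_def)
  moreover have "(\<Sum>i<n. of_bool (\<not> Q i)) = (0::nat) \<longleftrightarrow> (\<forall>i<n. Q i)" for n :: nat and Q
    by (subst sum_eq_0_iff) auto
  ultimately show ?thesis by simp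
qed

lemma recursive_fun_Least:
  assumes "recursive_pred (Suc k) (\<lambda>xs. P (tl xs) (hd xs))" and "\<And>xs. \<exists>n. P xs n"
  shows "recursive_fun k (\<lambda>xs. LEAST n. P xs n)"
proof -
  have "recursive_fun (Suc k) (\<lambda>xs. of_bool (\<not> P (tl xs) (hd xs)))"
    using recursive_pred_not[OF assms(1)] by (simp add: recursive_pred_def)
  from recursive_fun.minimize[OF this] show ?thesis
    using assms(2) by simp
qed

text \<open>Access to the outer environment from under at most four binders, which is the depth of
  the test \<open>good\<close>: three bounded quantifiers around a sum.\<close>

lemma recursive_fun_nth_tl:
  shows "Suc i < k \<Longrightarrow> recursive_fun k (\<lambda>xs. tl xs ! i)"
    and "Suc (Suc i) < k \<Longrightarrow> recursive_fun k (\<lambda>xs. tl (tl xs) ! i)"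
    and "Suc (Suc (Suc i)) < k \<Longrightarrow> recursive_fun k (\<lambda>xs. tl (tl (tl xs)) ! i)"
    and "Suc (Suc (Suc (Suc i))) < k \<Longrightarrow> recursive_fun k (\<lambda>xs. tl (tl (tl (tl xs))) ! i)"
  by (rule recursive_fun.cong[OF recursive_fun.proj], assumption, force simp: nth_tl)+

lemma recursive_fun_hd_tl:
  shows "1 < k \<Longrightarrow> recursive_fun k (\<lambda>xs. hd (tl xs))"
    and "2 < k \<Longrightarrow> recursive_fun k (\<lambda>xs. hd (tl (tl xs)))"
    and "3 < k \<Longrightarrow> recursive_fun k (\<lambda>xs. hd (tl (tl (tl xs))))"
  by (rule recursive_fun.cong[OF recursive_fun.proj], assumption,
      force simp: hd_conv_nth nth_tl eval_nat_numeral simp flip: length_greater_0_conv)+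

lemmas recursive_intros =
  recursive_fun.proj recursive_fun_nth_tl recursive_fun_hd recursive_fun_hd_tl
  recursive_fun_const recursive_fun_Suc recursive_fun_add recursive_fun_mult recursive_fun_power
  recursive_fun_diff recursive_fun_mod recursive_fun_if recursive_fun_sum recursive_pred_le
  recursive_pred_less recursive_pred_eq recursive_pred_conj recursive_pred_disj recursive_pred_imp
  recursive_pred_not recursive_pred_all_less

section \<open>Codes of rationals and computable reals\<close>

lemma recursive_fun_prod_encode:
  assumes f: "recursive_fun k f" and g: "recursive_fun k g"
  shows "recursive_fun k (\<lambda>xs. prod_encode (f xs, g xs))"
proof -
  have "triangle n = (\<Sum>i<n. Suc i)" for n by (induction n) auto
  then have "prod_encode (f xs, g xs) = (\<Sum>i<f xs + g xs. Suc i) + f xs" for xs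
    by (simp add: prod_encode_def)
  moreover have "recursive_fun k (\<lambda>xs. (\<Sum>i<f xs + g xs. Suc i) + f xs)"
    by (intro recursive_intros f g) simp
  ultimately show ?thesis by simp
qed

text \<open>The even numbers code the nonnegative integers, so doubling turns a natural number into
  its code as an integer.\<close>

lemma nat_to_rat_surj_code:
  assumes "q > 0"
  shows "nat_to_rat_surj (prod_encode (2 * p, 2 * q)) = of_nat p / of_nat q"
  using assms by (simp add: nat_to_rat_surj_def int_decode_def sum_decode_def Fract_of_int_quotient)

lemma computable_real_dyadic_limit:
  assumes "recursive_fun 1 (\<lambda>xs. a (xs ! 0))" and "recursive_fun 1 (\<lambda>xs. m (xs ! 0))"
    and "\<And>n. \<bar>real (a n) / 2 ^ m n - x\<bar> \<le> 1 / 2 ^ n"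
  shows "computable_real x"
proof -
  have "recursive_nat_rat (\<lambda>n. of_nat (a n) / of_nat (2 ^ m n))"
    unfolding recursive_nat_rat_def
  proof (intro exI conjI allI)
    show "recursive_fun 1 (\<lambda>xs. prod_encode (2 * a (xs ! 0), 2 * 2 ^ m (xs ! 0)))"
      by (intro recursive_fun_prod_encode recursive_intros assms)
    show "of_nat (a n) / of_nat (2 ^ m n)
        = nat_to_rat_surj (prod_encode (2 * a ([n] ! 0), 2 * 2 ^ m ([n] ! 0)))" for n
      by (subst nat_to_rat_surj_code) simp_all
  qed
  then show ?thesis
    using assms(3) unfolding computable_real_def
    by (intro exI[of _ "\<lambda>n. of_nat (a n) / of_nat (2 ^ m n)"]) (simp add: of_rat_divide of_rat_power)
qed


section \<open>Averages of periodic functions\<close>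

lemma periodic_of_int:
  fixes f :: "real \<Rightarrow> 'a"
  assumes per: "\<And>x. f (x + 1) = f x"
  shows "f (x + of_int k) = f x"
proof (induction k rule: int_induct[where k = 0])
  case (step1 i)
  then show ?case using per[of "x + of_int i"] by (simp add: algebra_simps)
next
  case (step2 i)
  then show ?case using per[of "x + of_int (i - 1)"] by (simp add: algebra_simps)
qed simp

lemma periodic_mult_nat:
  fixes f :: "real \<Rightarrow> 'a"
  assumes per: "\<And>x. f (x + 1) = f x"
  shows "f (real n * (x + 1)) = f (real n * x)"
  using periodic_of_int[of f "real n * x" "int n", OF per] by (simp add: algebra_simps)

text \<open>The substitution \<open>D * u - k\<close> maps the cell onto one period, and periodicity
  absorbs the integer shift.\<close>

lemma integral_periodic_cell:
  fixes f :: "real \<Rightarrow> real"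
  assumes cont: "continuous_on UNIV f" and per: "\<And>x. f (x + 1) = f x" and D: "D > 0"
  shows "integral {of_int k / D..(of_int k + 1) / D} (\<lambda>u. f (D * u)) = integral {0..1} f / D"
proof -
  have "f integrable_on {0..1}"
    using cont by (intro integrable_continuous_real) (auto intro: continuous_on_subset)
  then have "(f has_integral integral {0..1} f) (cbox 0 1)"
    by (simp add: integrable_integral)
  from has_integral_affinity'[OF this D, of "- of_int k"]
  have "((\<lambda>x. f (D * x + of_int (- k))) has_integral (integral {0..1} f / D))
      {of_int k / D..(of_int k + 1) / D}"
    by (simp add: divide_inverse mult.commute add.commute)
  then show ?thesis
    unfolding periodic_of_int[of f, OF per] by (rule integral_unique)
qed

lemma integral_periodic_cells:
  fixes f :: "real \<Rightarrow> real"
  assumes cont: "continuous_on UNIV f" and per: "\<And>x. f (x + 1) = f x" and D: "D > 0"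
  shows "integral {of_int k / D..(of_int k + real n) / D} (\<lambda>u. f (D * u))
    = real n * integral {0..1} f / D"
proof (induction n)
  case (Suc n)
  have cf: "continuous_on A (\<lambda>u. f (D * u))" for A
    by (intro continuous_on_compose2[OF cont] continuous_intros) auto
  have "integral {of_int k / D..(of_int k + real n) / D} (\<lambda>u. f (D * u))
      + integral {of_int (k + int n) / D..(of_int (k + int n) + 1) / D} (\<lambda>u. f (D * u))
      = integral {of_int k / D..(of_int k + real (Suc n)) / D} (\<lambda>u. f (D * u))"
    using Henstock_Kurzweil_Integration.integral_combine[of "of_int k / D" "(of_int k + real n) / D"
        "(of_int k + real (Suc n)) / D" "\<lambda>u. f (D * u)"] D
    by (simp add: divide_right_mono integrable_continuous_real[OF cf] add.commute add.left_commute)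
  moreover have "integral {of_int (k + int n) / D..(of_int (k + int n) + 1) / D} (\<lambda>u. f (D * u))
      = integral {0..1} f / D"
    by (rule integral_periodic_cell[OF cont per D])
  ultimately show ?case using Suc.IH by (simp add: add_divide_distrib distrib_right)
qed simp

lemma integral_periodic_mult:
  fixes f :: "real \<Rightarrow> real"
  assumes cont: "continuous_on UNIV f" and per: "\<And>x. f (x + 1) = f x" and B: "B > 0"
  shows "integral {0..1} (\<lambda>u. f (real B * u)) = integral {0..1} f"
  using integral_periodic_cells[OF cont per, of "real B" 0 B] B by simp

text \<open>The interval is covered by aligned cells of length \<open>1 / D\<close>. Their number is
  at most \<open>h * D + 2\<close>, hence at most \<open>3 * h * D\<close> as soon as the interval
  is at least one period long.\<close>

lemma integral_periodic_interval_le: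
  fixes f :: "real \<Rightarrow> real"
  assumes cont: "continuous_on UNIV f" and per: "\<And>x. f (x + 1) = f x"
    and nonneg: "\<And>x. f x \<ge> 0" and D: "D > 0" and Dh: "D * h \<ge> 1"
  shows "integral {\<alpha>..\<alpha> + h} (\<lambda>u. f (D * u)) \<le> 3 * h * integral {0..1} f"
proof -
  define k where "k = \<lfloor>\<alpha> * D\<rfloor>"
  define n where "n = nat (\<lceil>(\<alpha> + h) * D\<rceil> - k)"
  have h: "h > 0" using D Dh by (smt (verit) mult_nonneg_nonpos)
  have cf: "continuous_on A (\<lambda>u. f (D * u))" for A
    by (intro continuous_on_compose2[OF cont] continuous_intros) auto
  have "of_int k \<le> \<alpha> * D" unfolding k_def by simp
  moreover have k2: "\<alpha> * D < of_int k + 1" unfolding k_def by linarith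
  moreover have "\<lceil>(\<alpha> + h) * D\<rceil> \<ge> k"
    unfolding k_def using h D
    by (smt (verit, ccfv_SIG) ceiling_mono floor_le_ceiling mult_less_cancel_right_pos)
  then have n: "real n = of_int \<lceil>(\<alpha> + h) * D\<rceil> - of_int k"
    unfolding n_def by simp
  moreover have "(\<alpha> + h) * D \<le> of_int k + real n" using n by simp
  ultimately have sub: "{\<alpha>..\<alpha> + h} \<subseteq> {of_int k / D..(of_int k + real n) / D}"
    using D by (auto simp: field_simps)
  have "real n \<le> (\<alpha> + h) * D + 1 - of_int k" using n by linarith
  also have "\<dots> \<le> h * D + 2" using k2 by (simp add: algebra_simps)
  also have "\<dots> \<le> 3 * h * D" using Dh by (simp add: mult.commute)
  finally have nle: "real n / D \<le> 3 * h" using D by (simp add: field_simps)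
  have i0: "integral {0..1} f \<ge> 0" by (intro integral_nonneg integrable_continuous_real
        continuous_on_subset[OF cont]) (auto simp: nonneg)
  have "integral {\<alpha>..\<alpha> + h} (\<lambda>u. f (D * u))
      \<le> integral {of_int k / D..(of_int k + real n) / D} (\<lambda>u. f (D * u))"
    by (intro integral_subset_le sub integrable_continuous_real cf) (auto simp: nonneg)
  also have "\<dots> = real n / D * integral {0..1} f"
    using integral_periodic_cells[OF cont per D] by simp
  also have "\<dots> \<le> 3 * h * integral {0..1} f"
    using nle i0 by (rule mult_right_mono)
  finally show ?thesis .
qed

section \<open>Mean squares of sums along the orbit of multiplication by \<open>b\<close>\<close>

locale periodic_lipschitz =
  fixes \<phi> :: "real \<Rightarrow> real" and K :: real
  assumes per: "\<phi> (x + 1) = \<phi> x"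
    and lip: "\<bar>\<phi> x - \<phi> y\<bar> \<le> K * \<bar>x - y\<bar>"
    and bdd: "\<bar>\<phi> x\<bar> \<le> 1"
    and mean: "integral {0..1} \<phi> = 0"
begin

lemma K_nonneg: "K \<ge> 0"
  using lip[of 1 0] by simp

lemma cont: "continuous_on UNIV \<phi>"
proof -
  have "K-lipschitz_on UNIV \<phi>"
    using lip K_nonneg by (intro lipschitz_onI) (auto simp: dist_real_def)
  then show ?thesis by (rule lipschitz_on_continuous_on)
qed

lemma cont_mult: "continuous_on A (\<lambda>u. \<phi> (c * u))"
  by (intro continuous_on_compose2[OF cont] continuous_intros) auto

text \<open>On a cell of length \<open>1 / B\<close> the first factor is nearly constant, and the second has mean zero.\<close>

lemma correlation_cell:
  assumes B: "B > 0"
  shows "\<bar>integral {real t / B..(real t + 1) / B} (\<lambda>u. \<phi> u * \<phi> (real B * u))\<bar> \<le> K / (real B)\<^sup>2"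
proof -
  let ?a = "real t / B" and ?b = "(real t + 1) / B"
  have ab: "?b - ?a = 1 / B" using B by (simp add: field_simps)
  have c: "continuous_on A \<phi>" for A using cont by (rule continuous_on_subset) auto
  note ints = integrable_continuous_real continuous_intros c cont_mult
  have z: "integral {?a..?b} (\<lambda>u. \<phi> (real B * u)) = 0"
    using integral_periodic_cell[OF cont per, of "real B" "int t"] B mean by simp
  have "integral {?a..?b} (\<lambda>u. \<phi> u * \<phi> (real B * u))
      = integral {?a..?b} (\<lambda>u. (\<phi> u - \<phi> ?a) * \<phi> (real B * u) + \<phi> ?a * \<phi> (real B * u))"
    by (simp add: algebra_simps)
  also have "\<dots> = integral {?a..?b} (\<lambda>u. (\<phi> u - \<phi> ?a) * \<phi> (real B * u))
      + integral {?a..?b} (\<lambda>u. \<phi> ?a * \<phi> (real B * u))"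
    by (intro integral_add ints)
  also have "integral {?a..?b} (\<lambda>u. \<phi> ?a * \<phi> (real B * u)) = 0"
    using z by simp
  finally have "norm (integral {?a..?b} (\<lambda>u. \<phi> u * \<phi> (real B * u)))
      = norm (integral {?a..?b} (\<lambda>u. (\<phi> u - \<phi> ?a) * \<phi> (real B * u)))" by simp
  also have "\<dots> \<le> integral {?a..?b} (\<lambda>u. K / B)"
  proof (intro integral_norm_bound_integral ints)
    fix u assume u: "u \<in> {?a..?b}"
    have "\<bar>\<phi> u - \<phi> ?a\<bar> \<le> K * \<bar>u - ?a\<bar>" by (rule lip)
    also have "\<dots> \<le> K * (1 / B)"
      using u ab K_nonneg by (intro mult_left_mono) auto
    finally have "\<bar>\<phi> u - \<phi> ?a\<bar> * \<bar>\<phi> (real B * u)\<bar> \<le> K / B * 1"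
      using K_nonneg by (intro mult_mono bdd) auto
    then show "norm ((\<phi> u - \<phi> ?a) * \<phi> (real B * u)) \<le> K / B" by (simp add: abs_mult)
  qed
  also have "\<dots> = K / (real B)\<^sup>2"
    using ab B by (simp add: power2_eq_square field_simps)
  finally show ?thesis by simp
qed

text \<open>Each of the \<open>B\<close> cells of the unit interval contributes at most
  \<open>K / B^2\<close>.\<close>

lemma correlation:
  assumes B: "B > 0"
  shows "\<bar>integral {0..1} (\<lambda>u. \<phi> u * \<phi> (real B * u))\<bar> \<le> K / B"
proof -
  let ?f = "\<lambda>u. \<phi> u * \<phi> (real B * u)"
  have c: "continuous_on A ?f" for A
    by (intro continuous_intros cont_mult continuous_on_subset[OF cont]) auto
  have "\<bar>integral {0..real n / B} ?f\<bar> \<le> n * (K / (real B)\<^sup>2)" for n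
  proof (induction n)
    case (Suc n)
    have "integral {0..real n / B} ?f + integral {real n / B..(real n + 1) / B} ?f
        = integral {0..real (Suc n) / B} ?f"
      using Henstock_Kurzweil_Integration.integral_combine[of 0 "real n / B" "real (Suc n) / B" ?f]
      by (simp add: divide_right_mono integrable_continuous_real[OF c] add.commute)
    then have "\<bar>integral {0..real (Suc n) / B} ?f\<bar> \<le> n * (K / (real B)\<^sup>2) + K / (real B)\<^sup>2"
      using Suc.IH correlation_cell[OF B, of n] by linarith
    then show ?case by (simp only: of_nat_Suc distrib_right mult_1_left add.commute)
  qed simp
  from this[of B] show ?thesis using B by (simp add: power2_eq_square)
qed

definition orbit_sum :: "nat \<Rightarrow> nat \<Rightarrow> real \<Rightarrow> real" where
  "orbit_sum b n u = (\<Sum>i<n. \<phi> (real (b ^ i) * u))"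

lemma cont_orbit_sum: "continuous_on A (orbit_sum b n)"
  unfolding orbit_sum_def by (intro continuous_intros cont_mult)

lemma orbit_sum_periodic: "orbit_sum b n (u + 1) = orbit_sum b n u"
  unfolding orbit_sum_def by (intro sum.cong refl periodic_mult_nat per)

text \<open>Splitting off the first summand leaves a shorter sum of the same form at
  \<open>b * u\<close>, which has the same mean square as at \<open>u\<close> because multiplication
  by \<open>b\<close> preserves integrals over a period.\<close>

lemma orbit_sum_Suc: "orbit_sum b (Suc n) u = \<phi> u + orbit_sum b n (real b * u)"
  unfolding orbit_sum_def by (subst sum.lessThan_Suc_shift) (simp add: mult_ac)

text \<open>Expanding the square of \<open>\<phi> u + orbit_sum b n (b * u)\<close>, the first
  square has integral at most 1, the last is the induction hypothesis, and the correlations in the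
  cross term are dominated by a geometric series with ratio 1/2 and sum at most
  \<open>K\<close>.\<close>

lemma orbit_sum_variance:
  assumes b: "b \<ge> 2"
  shows "integral {0..1} (\<lambda>u. (orbit_sum b n u)\<^sup>2) \<le> n * (1 + 2 * K)"
proof (induction n)
  case 0
  then show ?case by (simp add: orbit_sum_def)
next
  case (Suc n)
  let ?S = "\<lambda>u. orbit_sum b n (real b * u)"
  have c: "continuous_on A \<phi>" for A using cont by (rule continuous_on_subset) auto
  have cS: "continuous_on A ?S" for A
    by (intro continuous_on_compose2[OF cont_orbit_sum[of UNIV]] continuous_intros) auto
  note ints = integrable_continuous_real continuous_intros c cS cont_mult
  have "integral {0..1} (\<lambda>u. (orbit_sum b (Suc n) u)\<^sup>2)
      = integral {0..1} (\<lambda>u. (\<phi> u)\<^sup>2 + (2 * (\<phi> u * ?S u) + (?S u)\<^sup>2))"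
    unfolding orbit_sum_Suc by (simp add: power2_eq_square algebra_simps)
  also have "\<dots> = integral {0..1} (\<lambda>u. (\<phi> u)\<^sup>2)
      + integral {0..1} (\<lambda>u. 2 * (\<phi> u * ?S u) + (?S u)\<^sup>2)"
    by (intro integral_add ints)
  also have "integral {0..1} (\<lambda>u. 2 * (\<phi> u * ?S u) + (?S u)\<^sup>2)
      = integral {0..1} (\<lambda>u. 2 * (\<phi> u * ?S u)) + integral {0..1} (\<lambda>u. (?S u)\<^sup>2)"
    by (intro integral_add ints)
  finally have eq: "integral {0..1} (\<lambda>u. (orbit_sum b (Suc n) u)\<^sup>2) = integral {0..1} (\<lambda>u. (\<phi> u)\<^sup>2)
      + 2 * integral {0..1} (\<lambda>u. \<phi> u * ?S u) + integral {0..1} (\<lambda>u. (?S u)\<^sup>2)"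
    by simp
  have "integral {0..1} (\<lambda>u. (\<phi> u)\<^sup>2) \<le> integral {0..1} (\<lambda>u::real. 1)"
    using bdd by (intro integral_le ints) (simp add: abs_square_le_1)
  then have 1: "integral {0..1} (\<lambda>u. (\<phi> u)\<^sup>2) \<le> 1" by simp
  have "integral {0..1} (\<lambda>u. \<phi> u * ?S u)
      = (\<Sum>i<n. integral {0..1} (\<lambda>u. \<phi> u * \<phi> (real (b ^ Suc i) * u)))"
    unfolding orbit_sum_def sum_distrib_left
    by (subst integral_sum)
       (auto intro!: ints simp flip: of_nat_mult mult.assoc power_Suc2 simp del: of_nat_power)
  also have "\<dots> \<le> (\<Sum>i<n. K * (1/2) ^ Suc i)"
  proof (rule sum_mono)
    fix i
    have "integral {0..1} (\<lambda>u. \<phi> u * \<phi> (real (b ^ Suc i) * u)) \<le> K / real (b ^ Suc i)"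
      using correlation[of "b ^ Suc i"] b by simp
    also have "\<dots> \<le> K / 2 ^ Suc i"
      using K_nonneg b by (intro divide_left_mono)
        (simp_all only: of_nat_power, auto intro!: power_mono mult_pos_pos simp del: power_Suc)
    finally show "integral {0..1} (\<lambda>u. \<phi> u * \<phi> (real (b ^ Suc i) * u)) \<le> K * (1/2) ^ Suc i"
      by (simp add: power_one_over)
  qed
  also have "\<dots> = K * (1 - (1/2) ^ n)"
    unfolding sum_distrib_left[symmetric] by (induction n) (simp_all add: field_simps)
  also have "\<dots> \<le> K" using K_nonneg by (simp add: mult_left_le)
  finally have 2: "integral {0..1} (\<lambda>u. \<phi> u * ?S u) \<le> K" .
  have 3: "integral {0..1} (\<lambda>u. (?S u)\<^sup>2) = integral {0..1} (\<lambda>u. (orbit_sum b n u)\<^sup>2)"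
    using b by (intro integral_periodic_mult[where f = "\<lambda>u. (orbit_sum b n u)\<^sup>2"])
      (auto intro!: continuous_intros cont_orbit_sum simp: orbit_sum_periodic)
  show ?case using eq 1 2 3 Suc.IH by (simp add: algebra_simps)
qed

lemma orbit_sum_variance_interval:
  assumes b: "b \<ge> 2" and D: "D > 0" "D * h \<ge> 1"
  shows "integral {\<alpha>..\<alpha> + h} (\<lambda>u. (orbit_sum b n (D * u))\<^sup>2) \<le> h * (3 * n * (1 + 2 * K))"
proof -
  have h: "h > 0" using D by (smt (verit) mult_nonneg_nonpos)
  have "integral {\<alpha>..\<alpha> + h} (\<lambda>u. (orbit_sum b n (D * u))\<^sup>2)
     \<le> 3 * h * integral {0..1} (\<lambda>u. (orbit_sum b n u)\<^sup>2)"
    by (intro integral_periodic_interval_le D)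
       (auto intro!: continuous_intros cont_orbit_sum simp: orbit_sum_periodic)
  also have "\<dots> \<le> 3 * h * (n * (1 + 2 * K))"
    using h by (intro mult_left_mono orbit_sum_variance b) auto
  finally show ?thesis by (simp add: mult_ac)
qed

end


section \<open>Tent functions along exponential orbits\<close>

text \<open>A hat of height 1 with peak at \<open>k / N\<close> and half width \<open>1 / N\<close>,
  extended periodically. For \<open>0 < k < N\<close> it vanishes at the integers, so the jump of
  \<open>frac\<close> does no harm.\<close>

definition tent :: "nat \<Rightarrow> nat \<Rightarrow> real \<Rightarrow> real" where
  "tent N k z = max 0 (1 - \<bar>real N * frac z - real k\<bar>)"

lemma tent_bounds: "0 \<le> tent N k z" "tent N k z \<le> 1"
  by (auto simp: tent_def)

lemma tent_periodic: "tent N k (z + 1) = tent N k z"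
  by (simp add: tent_def frac_1_eq)

text \<open>If no integer separates the points, this is the slope of the hat. Otherwise each of the
  two nonnegative values is at most \<open>N\<close> times the distance of its point to an integer
  lying between them, where the tent is 0.\<close>

lemma tent_lipschitz:
  assumes "0 < k" "k < N"
  shows "\<bar>tent N k z - tent N k w\<bar> \<le> N * \<bar>z - w\<bar>"
proof -
  have *: "\<bar>tent N k z - tent N k w\<bar> \<le> N * \<bar>z - w\<bar>" if "z \<le> w" for z w :: real
  proof (cases "\<lfloor>z\<rfloor> = \<lfloor>w\<rfloor>")
    case True
    then have "real N * frac w - real N * frac z = N * (w - z)"
      by (simp add: frac_def algebra_simps)
    moreover have "real N * (w - z) \<ge> 0" using that by simp
    ultimately have "\<bar>tent N k z - tent N k w\<bar> \<le> N * (w - z)"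
      unfolding tent_def by linarith
    then show ?thesis using that by simp
  next
    case False
    then have "\<lfloor>z\<rfloor> + 1 \<le> \<lfloor>w\<rfloor>" using that floor_mono[OF that] by linarith
    then have le: "of_int \<lfloor>z\<rfloor> + 1 \<le> (of_int \<lfloor>w\<rfloor> :: real)" by linarith
    have "of_int \<lfloor>w\<rfloor> \<le> w" by simp
    moreover have "z < of_int \<lfloor>z\<rfloor> + 1" by simp
    ultimately have fr: "1 - frac z \<le> w - z" "frac w \<le> w - z"
      using le unfolding frac_def by linarith+
    note tent_bounds[of N k z] tent_bounds[of N k w]
    moreover have "tent N k z \<le> N * (1 - frac z)"
    proof -
      have "real N * frac z \<le> N" by (simp add: frac_lt_1 less_imp_le mult_left_le)
      moreover have "real k + 1 \<le> N" using assms by linarith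
      ultimately show ?thesis unfolding tent_def right_diff_distrib by linarith
    qed
    moreover have "tent N k w \<le> N * frac w"
    proof -
      have "0 \<le> real N * frac w" by simp
      moreover have "1 \<le> real k" using assms by simp
      ultimately show ?thesis unfolding tent_def by linarith
    qed
    moreover have "N * (1 - frac z) \<le> N * (w - z)" "N * frac w \<le> N * (w - z)"
      using fr by (auto intro: mult_left_mono)
    moreover have "\<bar>z - w\<bar> = w - z" using that by simp
    ultimately show ?thesis by (simp only:)
  qed
  show ?thesis
    using *[of z w] *[of w z] by (cases "z \<le> w") (auto simp: abs_minus_commute)
qed

lemma DERIV_half_square_pos_part:
  "((\<lambda>u::real. (max 0 u)\<^sup>2 / 2) has_real_derivative max 0 x) (at x)"
proof (cases x "0 :: real" rule: linorder_cases)
  case less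
  have "((\<lambda>u::real. 0) has_real_derivative max 0 x) (at x)"
    using less by (auto intro!: derivative_eq_intros)
  then show ?thesis
    by (rule has_field_derivative_transform_within[where d = "-x"]) (use less in \<open>auto simp: dist_real_def\<close>)
next
  case equal
  \<comment> \<open>At the kink the difference quotient is at most
    \<open>\<bar>h\<bar>\<close>.\<close>
  have "(\<lambda>h::real. (max 0 h)\<^sup>2 / 2 / h) \<midarrow>0\<rightarrow> 0"
  proof (rule Lim_null_comparison)
    show "\<forall>\<^sub>F h in at (0::real). norm ((max 0 h)\<^sup>2 / 2 / h) \<le> \<bar>h\<bar>"
      by (auto intro!: always_eventually simp: max_def power2_eq_square abs_mult divide_simps)
    show "((\<lambda>h::real. \<bar>h\<bar>) \<longlongrightarrow> 0) (at 0)" by (auto intro!: tendsto_eq_intros)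
  qed
  then show ?thesis using equal by (simp add: DERIV_def)
next
  case greater
  have "((\<lambda>u::real. u\<^sup>2 / 2) has_real_derivative max 0 x) (at x)"
    using greater by (auto intro!: derivative_eq_intros)
  then show ?thesis
    by (rule has_field_derivative_transform_within[where d = "x"]) (use greater in \<open>auto simp: dist_real_def\<close>)
qed

lemma integral_tent:
  assumes "0 < k" "k < N"
  shows "integral {0..1} (tent N k) = 1 / N"
proof -
  \<comment> \<open>The tent is a second difference of \<open>max 0\<close>, and \<open>G\<close> is the corresponding antiderivative.\<close>
  define F where "F c u = (max 0 (real N * u - c))\<^sup>2 / 2 / N" for c u
  define G where "G u = F (real k - 1) u - 2 * F (real k) u + F (real k + 1) u" for u
  have N: "real N > 0" "real k + 1 \<le> N" "1 \<le> real k" using assms by auto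
  have F: "(F c has_real_derivative max 0 (real N * u - c)) (at u)" for c u
  proof -
    have "((\<lambda>u. real N * u - c) has_real_derivative real N) (at u)"
      by (auto intro!: derivative_eq_intros)
    from DERIV_cdivide[OF DERIV_chain2[OF DERIV_half_square_pos_part this], of "real N"]
    show ?thesis unfolding F_def using N by simp
  qed
  have "(tent N k has_integral G 1 - G 0) {0..1}"
  proof (rule fundamental_theorem_of_calculus)
    fix u :: real assume u: "u \<in> {0..1}"
    have "tent N k u = max 0 (real N * u - (real k - 1)) - 2 * max 0 (real N * u - real k)
        + max 0 (real N * u - (real k + 1))"
    \<comment> \<open>At the right end point \<open>frac\<close> drops to 0, but both sides vanish
      there.\<close>
    proof (cases "u = 1")
      case True
      then show ?thesis using N by (simp add: tent_def max_def)
    next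
      case False
      then have "frac u = u" using u by (auto simp: frac_eq)
      then show ?thesis by (simp add: tent_def max_def abs_if)
    qed
    moreover have "(G has_real_derivative max 0 (real N * u - (real k - 1))
        - 2 * max 0 (real N * u - real k) + max 0 (real N * u - (real k + 1))) (at u)"
      unfolding G_def by (intro derivative_eq_intros F refl) (rule F | simp)+
    ultimately show "(G has_vector_derivative tent N k u) (at u within {0..1})"
      by (simp add: has_real_derivative_iff_has_vector_derivative has_vector_derivative_at_within)
  qed simp
  moreover have "G 1 - G 0 = 1 / N"
    using N by (simp add: G_def F_def max_def power2_eq_square field_simps)
  ultimately show ?thesis by (simp add: integral_unique)
qed

lemma tent_periodic_lipschitz:
  assumes "0 < k" "k < N"
  shows "periodic_lipschitz (\<lambda>z. tent N k z - 1 / N) N"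
proof
  fix x y :: real
  show "\<bar>(tent N k x - 1 / N) - (tent N k y - 1 / N)\<bar> \<le> N * \<bar>x - y\<bar>"
    using tent_lipschitz[OF assms] by simp
  have "1 / real N \<le> 1" using assms by (simp add: divide_simps)
  moreover have "0 \<le> 1 / real N" by simp
  ultimately show "\<bar>tent N k x - 1 / N\<bar> \<le> 1"
    using tent_bounds[of N k x] by linarith
  have "(real N)-lipschitz_on {0..1} (tent N k)"
    using tent_lipschitz[OF assms] by (intro lipschitz_onI) (auto simp: dist_real_def)
  then have "continuous_on {0..1} (tent N k)" by (rule lipschitz_on_continuous_on)
  then have "integral {0..1} (\<lambda>z. tent N k z - 1 / N) = integral {0..1} (tent N k) - 1 / N"
    by (subst integral_diff) (auto intro: integrable_continuous_real)
  then show "integral {0..1} (\<lambda>z. tent N k z - 1 / N) = 0"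
    using integral_tent[OF assms] by simp
qed (simp add: tent_periodic)

section \<open>Blocks of digits\<close>

definition block :: "nat \<Rightarrow> nat \<Rightarrow> nat set" where
  "block b s = {i. 2 ^ s ^ 8 \<le> b ^ i \<and> b ^ i < 2 ^ Suc s ^ 8}"

text \<open>The powers of \<open>b\<close> increase, so a block lies between two thresholds
  \<open>J\<close>. Each step at least doubles the power, so there are no more steps than factors 2
  between the levels.\<close>

lemma block_interval:
  assumes b: "b \<ge> 2"
  obtains j n where "block b s = {j..<j + n}" "2 ^ s ^ 8 \<le> b ^ j" "n \<le> Suc s ^ 8 - s ^ 8"
proof -
  define J where "J m = (LEAST i. (2::nat) ^ m \<le> b ^ i)" for m
  have J: "2 ^ m \<le> b ^ i \<longleftrightarrow> J m \<le> i" for m i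
  proof
    have "2 ^ m \<le> b ^ m" using b by (rule power_mono) simp
    then have "2 ^ m \<le> b ^ J m" unfolding J_def by (rule LeastI)
    also assume "J m \<le> i"
    then have "b ^ J m \<le> b ^ i" using b by (intro power_increasing) auto
    finally show "2 ^ m \<le> b ^ i" .
  qed (auto simp: J_def intro: Least_le)
  let ?m = "s ^ 8" and ?M = "Suc s ^ 8"
  have "(2::nat) ^ ?m \<le> 2 ^ ?M" by (intro power_increasing power_mono) auto
  also have "2 ^ ?M \<le> b ^ J ?M" by (simp add: J)
  finally have JJ: "J ?m \<le> J ?M" using J by blast
  have "J ?M - J ?m \<le> ?M - ?m"
  proof (cases "J ?m < J ?M")
    case True
    then obtain n where n: "J ?M = Suc (J ?m + n)" using less_iff_Suc_add by blast
    have "(2::nat) ^ (?m + n) \<le> b ^ J ?m * b ^ n"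
      unfolding power_add using b by (intro mult_mono power_mono) (auto simp: J)
    also have "\<dots> = b ^ (J ?m + n)" by (simp add: power_add)
    also have "\<dots> < 2 ^ ?M" using J[of ?M "J ?m + n"] n by simp
    finally have "?m + n < ?M" by simp
    then show ?thesis using n by simp
  qed simp
  moreover have "block b s = {J ?m..<J ?m + (J ?M - J ?m)}"
    unfolding block_def using JJ J[of ?m] J[of ?M] by (auto simp flip: not_le simp del: power_Suc)
  ultimately show ?thesis using that[of "J ?m" "J ?M - J ?m"] J by blast
qed

lemma finite_block: "b \<ge> 2 \<Longrightarrow> finite (block b s)"
  by (metis block_interval finite_atLeastLessThan)

lemma card_block: "b \<ge> 2 \<Longrightarrow> card (block b s) \<le> Suc s ^ 8 - s ^ 8"
  by (metis block_interval card_atLeastLessThan diff_add_inverse)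

lemma sum_power_le:
  fixes b :: nat
  assumes "b \<ge> 2"
  shows "(\<Sum>i<n. b ^ i) \<le> b ^ n"
proof (induction n)
  case (Suc n)
  then have "(\<Sum>i<Suc n. b ^ i) \<le> 2 * b ^ n" by simp
  also have "\<dots> \<le> b ^ Suc n" using assms by simp
  finally show ?case .
qed simp

text \<open>A geometric sum is at most twice its last term. Up to the factor \<open>N\<close>, the
  left side is a Lipschitz constant of the tent sum over the block.\<close>

lemma sum_block_power_le:
  assumes b: "b \<ge> 2"
  shows "(\<Sum>i\<in>block b s. b ^ i) \<le> 2 * 2 ^ Suc s ^ 8"
proof -
  obtain j n where jn: "block b s = {j..<j + n}" using block_interval[OF b] by metis
  show ?thesis
  proof (cases n)
    case (Suc l)
    then have "j + l \<in> block b s" unfolding jn by simp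
    then have lt: "b ^ (j + l) < 2 ^ Suc s ^ 8" by (simp add: block_def del: power_Suc)
    have "(\<Sum>i\<in>block b s. b ^ i) \<le> (\<Sum>i<Suc (j + l). b ^ i)"
      unfolding jn Suc by (intro sum_mono2) auto
    also have "\<dots> \<le> 2 * b ^ (j + l)" using sum_power_le[OF b, of "j + l"] by simp
    finally show ?thesis using lt by linarith
  qed (simp add: jn)
qed

section \<open>Deviations of tent sums from their mean over a block\<close>

definition deviation :: "nat \<Rightarrow> nat \<Rightarrow> nat \<Rightarrow> nat set \<Rightarrow> real \<Rightarrow> real" where
  "deviation b N k I x = (\<Sum>i\<in>I. tent N k (real (b ^ i) * x) - 1 / N)"

text \<open>The summands have Lipschitz constants \<open>N * b ^ i\<close>. Over the block these add
  up to at most \<open>2 * N\<close> times the reciprocal of the next interval length.\<close>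

lemma deviation_lipschitz:
  assumes b: "b \<ge> 2" and k: "0 < k" "k < N" and xy: "\<bar>x - y\<bar> \<le> 1 / 2 ^ Suc s ^ 8"
  shows "\<bar>deviation b N k (block b s) x - deviation b N k (block b s) y\<bar> \<le> 2 * N"
proof -
  have "\<bar>deviation b N k (block b s) x - deviation b N k (block b s) y\<bar>
      = \<bar>\<Sum>i\<in>block b s. tent N k (real (b ^ i) * x) - tent N k (real (b ^ i) * y)\<bar>"
    by (simp add: deviation_def flip: sum_subtractf)
  also have "\<dots> \<le> (\<Sum>i\<in>block b s. N * (real (b ^ i) * (1 / 2 ^ Suc s ^ 8)))"
  proof (intro order.trans[OF sum_abs] sum_mono)
    fix i
    have "\<bar>tent N k (real (b ^ i) * x) - tent N k (real (b ^ i) * y)\<bar>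
        \<le> N * \<bar>real (b ^ i) * x - real (b ^ i) * y\<bar>" by (rule tent_lipschitz[OF k])
    also have "\<bar>real (b ^ i) * x - real (b ^ i) * y\<bar> = real (b ^ i) * \<bar>x - y\<bar>"
      by (simp add: abs_mult flip: right_diff_distrib)
    also have "N * (real (b ^ i) * \<bar>x - y\<bar>) \<le> N * (real (b ^ i) * (1 / 2 ^ Suc s ^ 8))"
      by (intro mult_left_mono xy) auto
    finally show "\<bar>tent N k (real (b ^ i) * x) - tent N k (real (b ^ i) * y)\<bar>
        \<le> N * (real (b ^ i) * (1 / 2 ^ Suc s ^ 8))" .
  qed
  also have "\<dots> = N * (real (\<Sum>i\<in>block b s. b ^ i) / 2 ^ Suc s ^ 8)"
    by (simp add: sum_distrib_left sum_divide_distrib)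
  also have "\<dots> \<le> real N * 2"
  proof (intro mult_left_mono)
    have "real (\<Sum>i\<in>block b s. b ^ i) \<le> real (2 * 2 ^ Suc s ^ 8)"
      using sum_block_power_le[OF b] by (rule of_nat_mono)
    then show "real (\<Sum>i\<in>block b s. b ^ i) / 2 ^ Suc s ^ 8 \<le> 2"
      by (simp add: pos_divide_le_eq del: power_Suc)
  qed simp
  finally show ?thesis by (simp add: mult.commute)
qed

lemma continuous_on_deviation:
  assumes "0 < k" "k < N"
  shows "continuous_on A (deviation b N k I)"
  unfolding deviation_def
  by (intro continuous_intros periodic_lipschitz.cont_mult[OF tent_periodic_lipschitz[OF assms]])

text \<open>Pulling out the first power \<open>b ^ j\<close> of the block makes the deviation an
  orbit sum at \<open>b ^ j * x\<close>. The interval contains a full period of it since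
  \<open>2 ^ s ^ 8 \<le> b ^ j\<close>.\<close>

lemma deviation_variance:
  assumes b: "b \<ge> 2" and k: "0 < k" "k < N"
  shows "integral {\<alpha>..\<alpha> + 1 / 2 ^ s ^ 8} (\<lambda>x. (deviation b N k (block b s) x)\<^sup>2)
    \<le> 1 / 2 ^ s ^ 8 * (3 * real (Suc s ^ 8 - s ^ 8) * (1 + 2 * real N))"
proof -
  interpret periodic_lipschitz "\<lambda>z. tent N k z - 1 / N" N
    by (rule tent_periodic_lipschitz[OF k])
  obtain j n where jn: "block b s = {j..<j + n}" "2 ^ s ^ 8 \<le> b ^ j" "n \<le> Suc s ^ 8 - s ^ 8"
    by (rule block_interval[OF b])
  have "deviation b N k (block b s) x = orbit_sum b n (real (b ^ j) * x)" for x
    unfolding deviation_def orbit_sum_def jn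
    using sum.shift_bounds_nat_ivl[of "\<lambda>i. tent N k (real (b ^ i) * x) - 1 / N" 0 j n]
    by (simp add: add.commute atLeast0LessThan power_add mult_ac)
  then have "integral {\<alpha>..\<alpha> + 1 / 2 ^ s ^ 8} (\<lambda>x. (deviation b N k (block b s) x)\<^sup>2)
      = integral {\<alpha>..\<alpha> + 1 / 2 ^ s ^ 8} (\<lambda>x. (orbit_sum b n (real (b ^ j) * x))\<^sup>2)" by simp
  also have "\<dots> \<le> 1 / 2 ^ s ^ 8 * (3 * real n * (1 + 2 * real N))"
  proof (rule orbit_sum_variance_interval[OF b])
    have "real (2 ^ s ^ 8) \<le> real (b ^ j)" using jn(2) by (rule of_nat_mono)
    then show "1 \<le> real (b ^ j) * (1 / 2 ^ s ^ 8)" by (simp add: field_simps)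
  qed (use b in simp)
  also have "\<dots> \<le> 1 / 2 ^ s ^ 8 * (3 * real (Suc s ^ 8 - s ^ 8) * (1 + 2 * real N))"
    using of_nat_mono[OF jn(3), where 'a = real] by (intro mult_left_mono mult_right_mono) simp_all
  finally show ?thesis .
qed

text \<open>There are at most \<open>s ^ 3\<close> admissible triples. At a minimum point the sum of
  all squared deviations is at most its mean over the interval, and it bounds every single
  square.\<close>

lemma exists_small_deviation:
  obtains x where "x \<in> {\<alpha>..\<alpha> + 1 / 2 ^ s ^ 8}"
    and "\<And>b N k. b < s \<Longrightarrow> N < s \<Longrightarrow> 2 \<le> b \<Longrightarrow> 0 < k \<Longrightarrow> k < N \<Longrightarrow>
      (deviation b N k (block b s) x)\<^sup>2 \<le> real s ^ 3 * (3 * real (Suc s ^ 8 - s ^ 8) * (1 + 2 * real s))"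
proof -
  define T where "T = {(b, N, k). b < s \<and> N < s \<and> 2 \<le> b \<and> 0 < k \<and> k < N}"
  define g where "g = (\<lambda>(b, N, k) x. (deviation b N k (block b s) x)\<^sup>2)"
  let ?I = "{\<alpha>..\<alpha> + 1 / 2 ^ s ^ 8}"
  let ?C = "3 * real (Suc s ^ 8 - s ^ 8) * (1 + 2 * real s)"
  have sub: "T \<subseteq> {..<s} \<times> {..<s} \<times> {..<s}" by (auto simp: T_def)
  have fin: "finite T" by (rule finite_subset[OF sub]) auto
  have "card T \<le> card ({..<s} \<times> {..<s} \<times> {..<s})" by (rule card_mono[OF _ sub]) auto
  then have card: "card T \<le> s ^ 3" by (simp add: card_cartesian_product power3_eq_cube)
  have cg: "continuous_on A (g t)" if "t \<in> T" for t A
    using that by (auto simp: T_def g_def intro!: continuous_intros continuous_on_deviation)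
  define G where "G x = (\<Sum>t\<in>T. g t x)" for x
  have cG: "continuous_on ?I G"
    unfolding G_def by (intro continuous_on_sum cg)
  have ig: "integral ?I (g t) \<le> 1 / 2 ^ s ^ 8 * ?C" if "t \<in> T" for t
  proof -
    obtain b N k where t: "t = (b, N, k)" by (cases t)
    have bk: "b \<ge> 2" "0 < k" "k < N" "N < s" using that by (auto simp: T_def t)
    have "integral ?I (g t) \<le> 1 / 2 ^ s ^ 8 * (3 * real (Suc s ^ 8 - s ^ 8) * (1 + 2 * real N))"
      unfolding g_def t using deviation_variance[OF bk(1-3)] by simp
    also have "\<dots> \<le> 1 / 2 ^ s ^ 8 * ?C"
      using bk(4) by (intro mult_left_mono) auto
    finally show ?thesis .
  qed
  have "integral ?I G = (\<Sum>t\<in>T. integral ?I (g t))"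
    unfolding G_def by (intro integral_sum fin integrable_continuous_real cg)
  also have "\<dots> \<le> card T * (1 / 2 ^ s ^ 8 * ?C)"
    using ig by (rule sum_bounded_above)
  also have "\<dots> \<le> s ^ 3 * (1 / 2 ^ s ^ 8 * ?C)"
    using of_nat_mono[OF card, where 'a = real] by (intro mult_right_mono) auto
  finally have iG: "integral ?I G \<le> s ^ 3 * (1 / 2 ^ s ^ 8 * ?C)" .
  obtain x where x: "x \<in> ?I" "\<And>y. y \<in> ?I \<Longrightarrow> G x \<le> G y"
    using continuous_attains_inf[OF _ _ cG] by auto
  have "integral ?I (\<lambda>_. G x) \<le> integral ?I G"
    by (intro integral_le integrable_continuous_real cG x) auto
  then have "1 / 2 ^ s ^ 8 * G x \<le> 1 / 2 ^ s ^ 8 * (real s ^ 3 * ?C)"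
    using iG by (simp add: mult_ac)
  then have Gx: "G x \<le> real s ^ 3 * ?C"
    by (rule mult_left_le_imp_le) simp
  show ?thesis
  proof (rule that[OF x(1)])
    fix b N k assume "b < s" "N < s" "2 \<le> b" "0 < k" "k < N"
    then have "(b, N, k) \<in> T" by (simp add: T_def)
    then have "g (b, N, k) x \<le> G x"
      unfolding G_def by (intro member_le_sum fin) (auto simp: g_def)
    then show "(deviation b N k (block b s) x)\<^sup>2 \<le> real s ^ 3 * ?C"
      using Gx by (simp add: g_def)
  qed
qed

text \<open>\<open>255 = 2 ^ 8 - 1\<close> is the sum of the binomial coefficients other than the
  leading one.\<close>

lemma power8_Suc_diff_le:
  assumes "s \<ge> 1"
  shows "Suc s ^ 8 - s ^ 8 \<le> 255 * s ^ 7"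
proof -
  have p: "s ^ i \<le> s ^ 7" if "i \<le> 7" for i using assms that by (rule_tac power_increasing) auto
  have "Suc s ^ 8 = s ^ 8 + 8 * s ^ 7 + 28 * s ^ 6 + 56 * s ^ 5 + 70 * s ^ 4 + 56 * s ^ 3
      + 28 * s ^ 2 + 8 * s ^ 1 + s ^ 0"
    by (simp add: eval_nat_numeral algebra_simps)
  then show ?thesis using p[of 6] p[of 5] p[of 4] p[of 3] p[of 2] p[of 1] p[of 0] by linarith
qed

text \<open>The point of small deviation is replaced by the left end of a subinterval nearby. Half
  of the allowance \<open>s ^ 6\<close> covers the deviation at the point, the other half the change
  by at most \<open>2 * N\<close>.\<close>

lemma exists_good_child:
  assumes s: "s \<ge> 10000"
  obtains c where "c < 2 ^ (Suc s ^ 8 - s ^ 8)"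
    and "\<And>b N k. b < s \<Longrightarrow> N < s \<Longrightarrow> 2 \<le> b \<Longrightarrow> 0 < k \<Longrightarrow> k < N \<Longrightarrow>
      \<bar>deviation b N k (block b s) (real (a * 2 ^ (Suc s ^ 8 - s ^ 8) + c) / 2 ^ Suc s ^ 8)\<bar> \<le> real s ^ 6"
proof -
  define L where "L = Suc s ^ 8 - s ^ 8"
  define M where "M = Suc s ^ 8"
  have M: "M = s ^ 8 + L" unfolding L_def M_def by (simp add: power_mono)
  obtain x where x: "x \<in> {real a / 2 ^ s ^ 8..real a / 2 ^ s ^ 8 + 1 / 2 ^ s ^ 8}"
    and dev: "\<And>b N k. b < s \<Longrightarrow> N < s \<Longrightarrow> 2 \<le> b \<Longrightarrow> 0 < k \<Longrightarrow> k < N \<Longrightarrow>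
      (deviation b N k (block b s) x)\<^sup>2 \<le> real s ^ 3 * (3 * real L * (1 + 2 * real s))"
    unfolding L_def by (rule exists_small_deviation[of "real a / 2 ^ s ^ 8" s]) blast
  define z where "z = x * 2 ^ M - a * 2 ^ L"
  have "a / 2 ^ s ^ 8 * 2 ^ M \<le> x * 2 ^ M" "x * 2 ^ M \<le> (a / 2 ^ s ^ 8 + 1 / 2 ^ s ^ 8) * 2 ^ M"
    using x by (intro mult_right_mono; simp)+
  then have z: "0 \<le> z" "z \<le> 2 ^ L"
    by (auto simp: z_def M power_add distrib_right)
  \<comment> \<open>The cap matters at the right end of the interval, where the floor would be
    \<open>2 ^ L\<close>.\<close>
  define c where "c = min (nat \<lfloor>z\<rfloor>) (2 ^ L - 1)"
  have c: "c < 2 ^ L" unfolding c_def by (simp add: min_less_iff_disj)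
  have zc: "\<bar>z - c\<bar> \<le> 1"
  proof (cases "nat \<lfloor>z\<rfloor> \<le> 2 ^ L - 1")
    case True
    then have "real c = of_int \<lfloor>z\<rfloor>" using z by (simp add: c_def)
    then show ?thesis by linarith
  next
    case False
    then have "c = 2 ^ L - 1" by (simp add: c_def)
    then have "real c = 2 ^ L - 1" by (simp add: of_nat_diff)
    moreover have "real (2 ^ L) \<le> real (nat \<lfloor>z\<rfloor>)" using False by (intro of_nat_mono) linarith
    then have "2 ^ L \<le> real_of_int \<lfloor>z\<rfloor>" using z by simp
    then have "2 ^ L \<le> z" by linarith
    ultimately show ?thesis using z by simp
  qed
  define y where "y = real (a * 2 ^ L + c) / 2 ^ M"
  have "x - y = (z - c) / 2 ^ M" by (simp add: z_def y_def field_simps)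
  then have xy: "\<bar>x - y\<bar> \<le> 1 / 2 ^ Suc s ^ 8"
    using zc by (simp add: abs_divide divide_right_mono M_def del: power_Suc)
  show ?thesis
  proof (rule that)
    show "c < 2 ^ (Suc s ^ 8 - s ^ 8)" using c by (simp only: L_def)
  next
    fix b N k assume bNk: "b < s" "N < s" "2 \<le> b" "0 < k" "k < N"
    have sr: "real s \<ge> 10000" using s by simp
    have "L \<le> 255 * s ^ 7" unfolding L_def using s by (intro power8_Suc_diff_le) simp
    then have "real L \<le> real (255 * s ^ 7)" by (rule of_nat_mono)
    then have "3 * real L * (1 + 2 * real s) \<le> (3 * real (255 * s ^ 7)) * (3 * real s)"
      using sr by (intro mult_mono) auto
    then have "real s ^ 3 * (3 * real L * (1 + 2 * real s)) \<le> real s ^ 3 * ((3 * real (255 * s ^ 7)) * (3 * real s))"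
      by (intro mult_left_mono) auto
    \<comment> \<open>\<open>2295 = 3 * 255 * 3\<close>, with \<open>1 + 2 * s\<close> bounded by
      \<open>3 * s\<close>. The next step needs \<open>s\<close> to be at least
      \<open>4 * 2295 = 9180\<close>, whence the threshold 10000.\<close>
    also have "\<dots> = 2295 * real s ^ 11" by (simp add: eval_nat_numeral)
    also have "\<dots> \<le> (real s / 4) * real s ^ 11" using sr by (intro mult_right_mono) auto
    also have "\<dots> = (real s ^ 6 / 2)\<^sup>2" by (simp add: eval_nat_numeral)
    finally have "(deviation b N k (block b s) x)\<^sup>2 \<le> (real s ^ 6 / 2)\<^sup>2"
      using dev[OF bNk] by linarith
    then have "\<bar>deviation b N k (block b s) x\<bar> \<le> real s ^ 6 / 2"
      using abs_le_square_iff[of "deviation b N k (block b s) x" "real s ^ 6 / 2"] by simp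
    moreover have "\<bar>deviation b N k (block b s) x - deviation b N k (block b s) y\<bar> \<le> 2 * N"
      by (rule deviation_lipschitz[OF bNk(3-5) xy])
    moreover have "2 * real N \<le> real s ^ 6 / 2"
    proof -
      have "4 * real N \<le> real s * real s" using bNk sr by (intro mult_mono) auto
      also have "\<dots> = real s ^ 2" by (simp add: power2_eq_square)
      also have "\<dots> \<le> real s ^ 6" using sr by (intro power_increasing) auto
      finally show ?thesis by simp
    qed
    ultimately have "\<bar>deviation b N k (block b s) y\<bar> \<le> real s ^ 6" by linarith
    then show "\<bar>deviation b N k (block b s) (real (a * 2 ^ (Suc s ^ 8 - s ^ 8) + c) / 2 ^ Suc s ^ 8)\<bar>
        \<le> real s ^ 6"
      by (simp only: y_def L_def M_def)
  qed
qed


section \<open>The search for good intervals\<close>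

text \<open>For \<open>r < P\<close>, this is \<open>P\<close> times the value of the tent function at \<open>r / P\<close>; the two
  truncated differences add up to \<open>\<bar>N * r - k * P\<bar>\<close>.\<close>

definition tent_nat :: "nat \<Rightarrow> nat \<Rightarrow> nat \<Rightarrow> nat \<Rightarrow> nat" where
  "tent_nat P N k r = P - (N * r - k * P) - (k * P - N * r)"

text \<open>With denominators cleared: for \<open>P = 2 ^ Suc s ^ 8\<close> this is
  \<open>N * P\<close> times the sum of the tents at \<open>y / P\<close> over the block. The range
  of \<open>i\<close> contains the whole block when \<open>b \<ge> 2\<close>.\<close>

definition tent_sum :: "nat \<Rightarrow> nat \<Rightarrow> nat \<Rightarrow> nat \<Rightarrow> nat \<Rightarrow> nat" where
  "tent_sum s b N k y = (\<Sum>i<Suc s ^ 8. if 2 ^ s ^ 8 \<le> b ^ i \<and> b ^ i < 2 ^ Suc s ^ 8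
     then N * tent_nat (2 ^ Suc s ^ 8) N k (b ^ i * y mod 2 ^ Suc s ^ 8) else 0)"

text \<open>The expected value \<open>card (block b s) / N\<close> of the tent sum, scaled by the
  same factor \<open>N * P\<close>.\<close>

definition block_weight :: "nat \<Rightarrow> nat \<Rightarrow> nat" where
  "block_weight s b = (\<Sum>i<Suc s ^ 8. if 2 ^ s ^ 8 \<le> b ^ i \<and> b ^ i < 2 ^ Suc s ^ 8
     then 2 ^ Suc s ^ 8 else 0)"

text \<open>Two inequalities express a bound on an absolute difference within the natural
  numbers.\<close>

definition good :: "nat \<Rightarrow> nat \<Rightarrow> bool" where
  "good s y \<longleftrightarrow> (\<forall>b<s. \<forall>N<s. \<forall>k<s. 2 \<le> b \<longrightarrow> 0 < k \<longrightarrow> k < N \<longrightarrow>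
     tent_sum s b N k y \<le> block_weight s b + N * s ^ 6 * 2 ^ Suc s ^ 8 \<and>
     block_weight s b \<le> tent_sum s b N k y + N * s ^ 6 * 2 ^ Suc s ^ 8)"

lemma recursive_pred_good: "recursive_pred 2 (\<lambda>xs. good (xs ! 0) (xs ! 1))"
  unfolding good_def tent_sum_def block_weight_def tent_nat_def
  by (intro recursive_intros) simp_all

lemma frac_of_nat_div:
  assumes "P > 0"
  shows "frac (real n / real P) = real (n mod P) / real P"
proof -
  have "real n = real (P * (n div P) + n mod P)" by simp
  then have "real n / real P = of_int (int (n div P)) + real (n mod P) / real P"
    using assms by (simp only: of_nat_add of_nat_mult add_divide_distrib of_int_of_nat_eq) simp
  then show ?thesis
    using assms by (simp add: frac_unique_iff)
qed

lemma tent_nat: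
  assumes "P > 0"
  shows "real (tent_nat P N k (n mod P)) = P * tent N k (real n / P)"
proof -
  let ?r = "n mod P"
  have "real (tent_nat P N k ?r) = max 0 (real P - \<bar>real (N * ?r) - real (k * P)\<bar>)"
    unfolding tent_nat_def by linarith
  also have "real P - \<bar>real (N * ?r) - real (k * P)\<bar> = P * (1 - \<bar>real N * (real ?r / P) - real k\<bar>)"
  proof -
    have "real (N * ?r) - real (k * P) = P * (real N * (real ?r / P) - real k)"
      using assms by (simp add: field_simps)
    then have "\<bar>real (N * ?r) - real (k * P)\<bar> = P * \<bar>real N * (real ?r / P) - real k\<bar>"
      by (simp add: abs_mult)
    then show ?thesis by (simp add: right_diff_distrib)
  qed
  also have "max 0 \<dots> = P * max 0 (1 - \<bar>real N * (real ?r / P) - real k\<bar>)"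
    by (simp add: max_mult_distrib_left)
  finally show ?thesis
    unfolding tent_def frac_of_nat_div[OF assms] .
qed

lemma block_eq_filter:
  assumes "b \<ge> 2"
  shows "block b s = {i \<in> {..<Suc s ^ 8}. 2 ^ s ^ 8 \<le> b ^ i \<and> b ^ i < 2 ^ Suc s ^ 8}"
proof -
  have "i < Suc s ^ 8" if "b ^ i < 2 ^ Suc s ^ 8" for i
  proof -
    have "(2::nat) ^ i \<le> b ^ i" using assms by (rule power_mono) simp
    also note that
    finally show ?thesis by (simp del: power_Suc)
  qed
  then show ?thesis unfolding block_def by blast
qed

text \<open>Dividing the integer test by \<open>N * P\<close> gives the bound on the
  deviation.\<close>

lemma good_iff:
  "good s y \<longleftrightarrow> (\<forall>b<s. \<forall>N<s. \<forall>k<s. 2 \<le> b \<longrightarrow> 0 < k \<longrightarrow> k < N \<longrightarrow>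
     \<bar>deviation b N k (block b s) (real y / 2 ^ Suc s ^ 8)\<bar> \<le> real s ^ 6)"
proof -
  define P :: nat where "P = 2 ^ Suc s ^ 8"
  have P: "P > 0" by (simp add: P_def)
  have "tent_sum s b N k y \<le> block_weight s b + N * s ^ 6 * P \<and>
      block_weight s b \<le> tent_sum s b N k y + N * s ^ 6 * P \<longleftrightarrow>
      \<bar>deviation b N k (block b s) (real y / P)\<bar> \<le> real s ^ 6"
    if b: "2 \<le> b" and k: "0 < k" "k < N" for b N k
  proof -
    note filter = sum.inter_filter[OF finite_lessThan, symmetric]
    have blk: "{i \<in> {..<Suc s ^ 8}. 2 ^ s ^ 8 \<le> b ^ i \<and> b ^ i < P} = block b s"
      unfolding P_def by (rule block_eq_filter[OF b, symmetric])
    have N: "real N * P > 0" using k P by simp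
    have "real (tent_sum s b N k y) = (\<Sum>i\<in>block b s. real N * P * tent N k (real (b ^ i) * (real y / P)))"
      unfolding tent_sum_def filter P_def[symmetric] blk of_nat_sum
      by (intro sum.cong refl) (simp add: tent_nat[OF P] mult.assoc)
    moreover have "real (block_weight s b) = (\<Sum>i\<in>block b s. real N * P * (1 / N))"
      unfolding block_weight_def filter P_def[symmetric] blk using k by simp
    ultimately have "real (tent_sum s b N k y) - real (block_weight s b)
        = real N * P * deviation b N k (block b s) (real y / P)"
      by (simp only: deviation_def sum_distrib_left right_diff_distrib sum_subtractf)
    then have "\<bar>real (tent_sum s b N k y) - real (block_weight s b)\<bar>
        = real N * P * \<bar>deviation b N k (block b s) (real y / P)\<bar>"
      using N by (simp add: abs_mult)
    moreover have "tent_sum s b N k y \<le> block_weight s b + N * s ^ 6 * P \<and>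
        block_weight s b \<le> tent_sum s b N k y + N * s ^ 6 * P \<longleftrightarrow>
        \<bar>real (tent_sum s b N k y) - real (block_weight s b)\<bar> \<le> real (N * s ^ 6 * P)"
      by linarith
    moreover have "real (N * s ^ 6 * P) = real N * P * real s ^ 6" by simp
    ultimately show ?thesis using N by (simp only: mult_le_cancel_left_pos)
  qed
  then show ?thesis unfolding good_def P_def[symmetric] by (auto simp: P_def)
qed

section \<open>Descent through nested dyadic intervals\<close>

text \<open>The second disjunct makes the search terminate for all arguments, as minimization
  requires. Where a good subinterval exists, the search stops at one before reaching that
  bound.\<close>

definition child :: "nat \<Rightarrow> nat \<Rightarrow> nat" where
  "child s a = a * 2 ^ (Suc s ^ 8 - s ^ 8) +
     (LEAST c. good s (a * 2 ^ (Suc s ^ 8 - s ^ 8) + c) \<or> 2 ^ (Suc s ^ 8 - s ^ 8) \<le> c)"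

primrec descent :: "nat \<Rightarrow> nat \<Rightarrow> nat \<Rightarrow> nat" where
  "descent s a 0 = a"
| "descent s a (Suc n) = child (s + n) (descent s a n)"

lemma recursive_fun_child: "recursive_fun 2 (\<lambda>xs. child (xs ! 0) (xs ! 1))"
proof -
  have good: "recursive_pred k (\<lambda>xs. good (f xs) (g xs))" if "recursive_fun k f" "recursive_fun k g" for k f g
    using recursive_fun_comp2[OF recursive_pred_good[unfolded recursive_pred_def] that]
    by (simp add: recursive_pred_def)
  show ?thesis
    unfolding child_def by (intro recursive_fun_Least good recursive_intros) auto
qed

lemma recursive_fun_descent: "recursive_fun 1 (\<lambda>xs. descent s a (xs ! 0))"
proof -
  have "descent s a n = rec_nat a (\<lambda>n. child (s + n)) n" for n
    by (induction n) auto
  moreover have "recursive_fun 1 (\<lambda>xs. rec_nat a ((\<lambda>xs n r. child (s + n) r) xs) (xs ! 0))"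
    by (intro recursive_fun_rec_nat recursive_fun_comp2[OF recursive_fun_child] recursive_intros) auto
  ultimately show ?thesis by simp
qed

lemma child_good:
  assumes "s \<ge> 10000"
  obtains c where "child s a = a * 2 ^ (Suc s ^ 8 - s ^ 8) + c" "c < 2 ^ (Suc s ^ 8 - s ^ 8)"
    "good s (child s a)"
proof -
  define L where "L = Suc s ^ 8 - s ^ 8"
  define c where "c = (LEAST c. good s (a * 2 ^ L + c) \<or> 2 ^ L \<le> c)"
  have ch: "child s a = a * 2 ^ L + c" by (simp only: child_def c_def L_def)
  obtain d where d: "d < 2 ^ L" "good s (a * 2 ^ L + d)"
    unfolding L_def good_iff by (rule exists_good_child[OF assms, of a]) blast
  then have "c \<le> d" unfolding c_def by (intro Least_le) blast
  with d have c: "c < 2 ^ L" by simp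
  have "good s (a * 2 ^ L + c) \<or> 2 ^ L \<le> c" unfolding c_def by (rule LeastI) (use d in blast)
  with c ch show ?thesis using that[of c] by (simp only: L_def) auto
qed

lemma descent_limit:
  assumes s: "s \<ge> 10000"
  obtains x where
    "\<And>n. real (descent s a n) / 2 ^ (s + n) ^ 8 \<le> x"
    "\<And>n. x \<le> real (descent s a n) / 2 ^ (s + n) ^ 8 + 1 / 2 ^ (s + n) ^ 8"
proof -
  define l where "l n = real (descent s a n) / 2 ^ (s + n) ^ 8" for n
  define u where "u n = l n + 1 / 2 ^ (s + n) ^ 8" for n
  have step: "l n \<le> l (Suc n) \<and> u (Suc n) \<le> u n" for n
  proof -
    define L where "L = Suc (s + n) ^ 8 - (s + n) ^ 8"
    obtain c where c: "descent s a (Suc n) = descent s a n * 2 ^ L + c" "c < 2 ^ L"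
      using child_good[of "s + n" "descent s a n"] s unfolding L_def by auto
    have M: "(s + Suc n) ^ 8 = (s + n) ^ 8 + L"
      unfolding L_def by (simp add: power_mono)
    have lS: "l (Suc n) = l n + real c / 2 ^ L / 2 ^ (s + n) ^ 8"
      unfolding l_def M c(1) power_add by (simp add: field_simps)
    \<comment> \<open>\<open>c + 1 \<le> 2 ^ L\<close> keeps the right end of the subinterval inside
      the old interval.\<close>
    have "real (Suc c) \<le> real (2 ^ L)" using c(2) by (intro of_nat_mono) simp
    then have "(real c + 1) / 2 ^ L \<le> 1" by (simp add: pos_divide_le_eq)
    then have "(real c + 1) / 2 ^ L / 2 ^ (s + n) ^ 8 \<le> 1 / 2 ^ (s + n) ^ 8"
      by (rule divide_right_mono) simp
    moreover have "u (Suc n) = l n + (real c + 1) / 2 ^ L / 2 ^ (s + n) ^ 8"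
      unfolding u_def lS M power_add by (simp add: add_divide_distrib mult.commute)
    ultimately show ?thesis by (simp add: lS u_def)
  qed
  have inc: "incseq l" and dec: "decseq u"
    using step by (auto intro: incseq_SucI decseq_SucI)
  have lu: "l n \<le> u m" for n m
  proof -
    have "l n \<le> l (max n m)" using inc by (simp add: incseq_def)
    also have "\<dots> \<le> u (max n m)" by (simp add: u_def)
    also have "\<dots> \<le> u m" using dec by (simp add: decseq_def)
    finally show ?thesis .
  qed
  obtain x where x: "l \<longlonglongrightarrow> x" "\<And>n. l n \<le> x"
    using incseq_convergent[OF inc, of "u 0"] lu by blast
  have "x \<le> u m" for m using x(1) lu by (intro LIMSEQ_le_const2) auto
  with x(2) show ?thesis using that[of x] by (simp add: l_def u_def)
qed

lemma descent_computable:
  assumes "\<And>n. real (descent s a n) / 2 ^ (s + n) ^ 8 \<le> x"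
    and "\<And>n. x \<le> real (descent s a n) / 2 ^ (s + n) ^ 8 + 1 / 2 ^ (s + n) ^ 8"
  shows "computable_real x"
proof (rule computable_real_dyadic_limit[OF recursive_fun_descent[of s a]])
  show "recursive_fun 1 (\<lambda>xs. (s + xs ! 0) ^ 8)" by (intro recursive_intros) simp
  fix n
  have "n \<le> (s + n) ^ 8" using self_le_power[of "s + n" 8] by (cases "s + n = 0") auto
  then have "1 / 2 ^ (s + n) ^ 8 \<le> (1 :: real) / 2 ^ n"
    by (intro divide_left_mono power_increasing) auto
  moreover have "\<bar>l - x\<bar> \<le> e'" if "l \<le> x" "x \<le> l + e" "e \<le> e'" for l e e' :: real
    using that by linarith
  ultimately show "\<bar>real (descent s a n) / 2 ^ (s + n) ^ 8 - x\<bar> \<le> 1 / 2 ^ n"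
    using assms(1)[of n] assms(2)[of n] by blast
qed

text \<open>The block at level \<open>t\<close> was tested at the left end of the interval of level
  \<open>Suc t\<close>, which also contains \<open>x\<close>. Moving to \<open>x\<close> costs
  \<open>2 * N\<close>, at most \<open>2 * t ^ 6\<close>.\<close>

lemma descent_deviation:
  assumes s: "s \<ge> 10000"
    and lower: "\<And>n. real (descent s a n) / 2 ^ (s + n) ^ 8 \<le> x"
    and upper: "\<And>n. x \<le> real (descent s a n) / 2 ^ (s + n) ^ 8 + 1 / 2 ^ (s + n) ^ 8"
    and t: "t \<ge> s" and bNk: "b < t" "N < t" "2 \<le> b" "0 < k" "k < N"
  shows "\<bar>deviation b N k (block b t) x\<bar> \<le> 3 * real t ^ 6"
proof -
  obtain n where n: "t = s + n" using t le_Suc_ex by blast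
  define y where "y = descent s a (Suc n)"
  have "t \<ge> 10000" using s t by (rule order.trans)
  then have "good t (child t (descent s a n))" by (rule child_good)
  then have "good t y" by (simp only: y_def n descent.simps)
  then have "\<bar>deviation b N k (block b t) (real y / 2 ^ Suc t ^ 8)\<bar> \<le> real t ^ 6"
    using bNk unfolding good_iff by auto
  moreover have "\<bar>deviation b N k (block b t) x - deviation b N k (block b t) (real y / 2 ^ Suc t ^ 8)\<bar> \<le> 2 * N"
  proof (rule deviation_lipschitz[OF bNk(3-5)])
    have "\<bar>x - l\<bar> \<le> e" if "l \<le> x" "x \<le> l + e" for l e using that by linarith
    from this[OF lower[of "Suc n"] upper[of "Suc n"]]
    show "\<bar>x - real y / 2 ^ Suc t ^ 8\<bar> \<le> 1 / 2 ^ Suc t ^ 8"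
      by (simp only: y_def n add_Suc_right)
  qed
  moreover have "real N \<le> real t ^ 6"
    using bNk self_le_power[of "real t" 6] by simp
  ultimately show ?thesis by linarith
qed


section \<open>Equidistribution and normality\<close>

lemma deviation_union:
  "finite I \<Longrightarrow> finite J \<Longrightarrow> I \<inter> J = {} \<Longrightarrow>
    deviation b N k (I \<union> J) x = deviation b N k I x + deviation b N k J x"
  unfolding deviation_def by (rule sum.union_disjoint)

lemma deviation_le_card:
  assumes "0 < k" "k < N"
  shows "\<bar>deviation b N k I x\<bar> \<le> card I"
proof -
  have "\<bar>deviation b N k I x\<bar> \<le> (\<Sum>i\<in>I. 1)"
    unfolding deviation_def
    by (intro order.trans[OF sum_abs] sum_mono periodic_lipschitz.bdd[OF tent_periodic_lipschitz[OF assms]])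
  then show ?thesis by simp
qed

definition lower_block :: "nat \<Rightarrow> nat \<Rightarrow> nat set" where
  "lower_block b s = {i. b ^ i < 2 ^ s ^ 8}"

lemma finite_lower_block:
  assumes "b \<ge> 2"
  shows "finite (lower_block b s)"
proof (rule finite_subset)
  show "lower_block b s \<subseteq> {..<s ^ 8}"
  proof
    fix i assume "i \<in> lower_block b s"
    then have "b ^ i < 2 ^ s ^ 8" by (simp add: lower_block_def)
    moreover have "(2::nat) ^ i \<le> b ^ i" using assms by (rule power_mono) simp
    ultimately have "(2::nat) ^ i < 2 ^ s ^ 8" by linarith
    then show "i \<in> {..<s ^ 8}" by simp
  qed
qed simp

lemma lower_block_Suc: "lower_block b (Suc s) = lower_block b s \<union> block b s"
proof -
  have "(2::nat) ^ s ^ 8 \<le> 2 ^ Suc s ^ 8" by (intro power_increasing power_mono) auto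
  then show ?thesis unfolding lower_block_def block_def by (auto simp del: power_Suc intro: less_le_trans)
qed

lemma lower_block_disjoint: "lower_block b s \<inter> block b s = {}"
  by (auto simp: lower_block_def block_def simp del: power_Suc)

text \<open>Let \<open>t\<close> be the last level with \<open>2 ^ t ^ 8 \<le> b ^ n\<close>. If
  \<open>s \<le> t\<close>, the complete blocks from \<open>s\<close> to below \<open>t\<close>
  contribute \<open>3 * t ^ 7\<close> and the unfinished block at most its length
  \<open>255 * t ^ 7\<close>; otherwise all indices lie in \<open>lower_block b s\<close>. Finally
  \<open>t ^ 8 \<le> b * n\<close>.\<close>

lemma deviation_initial_le:
  assumes b: "b \<ge> 2" and k: "0 < k" "k < N"
    and dev: "\<And>t. t \<ge> s \<Longrightarrow> \<bar>deviation b N k (block b t) x\<bar> \<le> 3 * real t ^ 6"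
  shows "\<bar>deviation b N k {..<n} x\<bar> \<le> card (lower_block b s) + 258 * (real b * n) powr (7/8)"
proof -
  define C where "C = real (card (lower_block b s))"
  note fin = finite_lower_block[OF b] finite_block[OF b]
  have low: "\<bar>deviation b N k (lower_block b t) x\<bar> \<le> C + 3 * real t ^ 7" if "t \<ge> s" for t
    using that
  proof (induction rule: dec_induct)
    case base
    have "\<bar>deviation b N k (lower_block b s) x\<bar> \<le> C"
      unfolding C_def by (rule deviation_le_card[OF k])
    also have "\<dots> \<le> C + 3 * real s ^ 7" by simp
    finally show ?case .
  next
    case (step t)
    have "\<bar>deviation b N k (lower_block b (Suc t)) x\<bar> \<le> C + 3 * (real t ^ 7 + real t ^ 6)"
      unfolding lower_block_Suc deviation_union[OF fin lower_block_disjoint]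
      using add_mono[OF step.IH dev[OF step.hyps(1)]]
      by (intro order.trans[OF abs_triangle_ineq]) (simp add: distrib_left)
    also have "real t ^ 7 + real t ^ 6 = real (Suc t) * real t ^ 6"
      by (simp add: eval_nat_numeral algebra_simps)
    also have "\<dots> \<le> real (Suc t) * real (Suc t) ^ 6"
      by (intro mult_left_mono power_mono) auto
    also have "\<dots> = real (Suc t) ^ 7" by (simp add: eval_nat_numeral)
    finally show ?case by simp
  qed
  have "finite {t. (2::nat) ^ t ^ 8 \<le> b ^ n}"
  proof (rule finite_subset)
    show "{t. (2::nat) ^ t ^ 8 \<le> b ^ n} \<subseteq> {..b ^ n}"
    proof
      fix t assume "t \<in> {t. (2::nat) ^ t ^ 8 \<le> b ^ n}"
      then have "(2::nat) ^ t ^ 8 \<le> b ^ n" by simp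
      moreover have "t \<le> t ^ 8" using self_le_power[of t 8] by (cases "t = 0") auto
      moreover have "t ^ 8 < 2 ^ t ^ 8" by (rule less_exp)
      ultimately have "t \<le> b ^ n" by linarith
      then show "t \<in> {..b ^ n}" by simp
    qed
  qed simp
  moreover have "0 \<in> {t. (2::nat) ^ t ^ 8 \<le> b ^ n}" using b by simp
  ultimately obtain t where t: "(2::nat) ^ t ^ 8 \<le> b ^ n" "b ^ n < 2 ^ Suc t ^ 8"
    using Max_in[of "{t. (2::nat) ^ t ^ 8 \<le> b ^ n}"] Max_ge[of "{t. (2::nat) ^ t ^ 8 \<le> b ^ n}"]
    by (metis (mono_tags, lifting) empty_iff mem_Collect_eq not_less not_less_eq_eq order.refl)
  \<comment> \<open>The crude bound of \<open>b\<close> by \<open>2 ^ b\<close> avoids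
    logarithms.\<close>
  have "(2::nat) ^ t ^ 8 \<le> (2 ^ b) ^ n"
    using t(1) power_mono[of b "2 ^ b" n] less_exp[of b] by linarith
  then have "t ^ 8 \<le> b * n" by (simp flip: power_mult)
  then have "real t ^ 8 \<le> real b * n" by (metis of_nat_le_iff of_nat_mult of_nat_power)
  then have "(real t ^ 8) powr (7/8) \<le> (real b * n) powr (7/8)" by (intro powr_mono2) auto
  moreover have "(real t ^ 8) powr (7/8) = real t ^ 7"
  proof -
    have "(real t ^ 8) powr (7/8) = (real t powr 8) powr (7/8)" by simp
    also have "\<dots> = real t powr 7" by (simp add: powr_powr del: powr_numeral)
    finally show ?thesis by simp
  qed
  ultimately have t7: "real t ^ 7 \<le> (real b * n) powr (7/8)" by simp
  have "\<bar>deviation b N k {..<n} x\<bar> \<le> C + 258 * real t ^ 7"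
  proof (cases "s \<le> t")
    case True
    define J where "J = {i. i < n \<and> 2 ^ t ^ 8 \<le> b ^ i}"
    have lt: "b ^ i < b ^ n \<longleftrightarrow> i < n" for i using b by simp
    have "i < n" if "b ^ i < 2 ^ t ^ 8" for i
      using that t(1) lt[of i] by linarith
    then have eq: "{..<n} = lower_block b t \<union> J"
      by (auto simp: lower_block_def J_def)
    have disj: "lower_block b t \<inter> J = {}" by (auto simp: lower_block_def J_def)
    have "b ^ i < 2 ^ Suc t ^ 8" if "i < n" for i
      using that t(2) lt[of i] by linarith
    then have sub: "J \<subseteq> block b t" by (auto simp: J_def block_def simp del: power_Suc)
    have finJ: "finite J" by (simp add: J_def)
    have "card J \<le> 255 * t ^ 7"
    proof (cases "t = 0")
      case True
      then have "b ^ n < b ^ 1" using t(2) b by simp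
      then have "n = 0" using b power_less_imp_less_exp[of b n 1] by simp
      then show ?thesis by (simp add: J_def)
    next
      case False
      then have "Suc t ^ 8 - t ^ 8 \<le> 255 * t ^ 7" by (intro power8_Suc_diff_le) simp
      then show ?thesis using card_mono[OF fin(2) sub] card_block[OF b, of t] by linarith
    qed
    then have "real (card J) \<le> 255 * real t ^ 7"
      using of_nat_mono by fastforce
    then have "\<bar>deviation b N k J x\<bar> \<le> 255 * real t ^ 7"
      using deviation_le_card[OF k, of b J x] by linarith
    then show ?thesis
      unfolding eq deviation_union[OF fin(1) finJ disj]
      using low[OF True] by linarith
  next
    case False
    then have le: "(2::nat) ^ Suc t ^ 8 \<le> 2 ^ s ^ 8"
      by (intro power_increasing power_mono) auto
    have "b ^ i < 2 ^ s ^ 8" if "i < n" for i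
    proof -
      have "b ^ i < b ^ n" using that b by simp
      also note t(2)
      also note le
      finally show ?thesis .
    qed
    then have "{..<n} \<subseteq> lower_block b s" by (auto simp: lower_block_def)
    then have "card {..<n} \<le> card (lower_block b s)" by (rule card_mono[OF fin(1)])
    then have "\<bar>deviation b N k {..<n} x\<bar> \<le> C"
      using deviation_le_card[OF k, of b "{..<n}" x] unfolding C_def by linarith
    also have "\<dots> \<le> C + 258 * real t ^ 7" by simp
    finally show ?thesis .
  qed
  with t7 show ?thesis unfolding C_def by linarith
qed

text \<open>The exponent 7/8 is below 1, so the deviation is \<open>o(n)\<close>.\<close>

lemma tent_average_tendsto:
  assumes b: "b \<ge> 2" and k: "0 < k" "k < N"
    and dev: "\<And>t. t \<ge> s \<Longrightarrow> \<bar>deviation b N k (block b t) x\<bar> \<le> 3 * real t ^ 6"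
  shows "(\<lambda>n. (\<Sum>i<n. tent N k (real (b ^ i) * x)) / n) \<longlonglongrightarrow> 1 / N"
proof -
  define C where "C = real (card (lower_block b s))"
  have "(\<lambda>n. deviation b N k {..<n} x / n) \<longlonglongrightarrow> 0"
  proof (rule Lim_null_comparison)
    show "\<forall>\<^sub>F n in sequentially. norm (deviation b N k {..<n} x / n)
        \<le> (C + 258 * (real b * n) powr (7/8)) / n"
      using deviation_initial_le[OF b k dev]
      by (intro always_eventually) (simp add: abs_divide divide_right_mono C_def)
    have "real b > 0" using b by simp
    then show "(\<lambda>n. (C + 258 * (real b * real n) powr (7/8)) / real n) \<longlonglongrightarrow> 0"
      by real_asymp
  qed
  then have "(\<lambda>n. deviation b N k {..<n} x / n + 1 / N) \<longlonglongrightarrow> 0 + 1 / N"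
    by (intro tendsto_intros)
  moreover have "\<forall>\<^sub>F n in sequentially. deviation b N k {..<n} x / n + 1 / N
      = (\<Sum>i<n. tent N k (real (b ^ i) * x)) / n"
    using eventually_gt_at_top[of 0]
    by eventually_elim (simp add: deviation_def sum_subtractf field_simps)
  ultimately show ?thesis by (simp cong: filterlim_cong)
qed

section \<open>From tents to occurrences of words\<close>

fun word_value :: "nat \<Rightarrow> nat list \<Rightarrow> nat" where
  "word_value b [] = 0"
| "word_value b (d # w) = d * b ^ length w + word_value b w"

lemma word_value_less: "set w \<subseteq> {..<b} \<Longrightarrow> word_value b w < b ^ length w"
proof (induction w)
  case (Cons d w)
  then have "d * b ^ length w + word_value b w < Suc d * b ^ length w" by simp
  also have "\<dots> \<le> b * b ^ length w" using Cons.prems by (intro mult_right_mono) auto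
  finally show ?case by simp
qed simp

lemma occurs_at_Cons: "occurs_at (d # w) f i \<longleftrightarrow> f i = d \<and> occurs_at w f (Suc i)"
  by (auto simp: occurs_at_def nth_Cons split: nat.splits)

text \<open>Induction on the word: the bounds force the floor of \<open>b * frac z\<close> to be the
  first letter \<open>d\<close>, and the next fractional part \<open>b * frac z - d\<close> lies in
  the cell of the remaining word.\<close>

lemma occurs_at_if_in_cell:
  assumes "set w \<subseteq> {..<b}" and "0 \<le> x" "x < 1"
    and "real (word_value b w) \<le> real b ^ length w * frac (real (b ^ i) * x)"
    and "real b ^ length w * frac (real (b ^ i) * x) < real (word_value b w) + 1"
  shows "occurs_at w (digit b x) i"
  using assms
proof (induction w arbitrary: i)
  case Nil
  then show ?case by (simp add: occurs_at_def)
next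
  case (Cons d w)
  let ?z = "real (b ^ i) * x" and ?B = "real b ^ length w"
  have d: "d < b" and w: "set w \<subseteq> {..<b}" using Cons.prems(1) by auto
  have B: "?B > 0" using d by simp
  have "real (word_value b w) + 1 \<le> ?B"
    using word_value_less[OF w] by (metis Suc_eq_plus1 Suc_leI of_nat_1 of_nat_add of_nat_le_iff of_nat_power)
  then have "?B * (real b * frac ?z) < ?B * (real d + 1)"
    using Cons.prems(5) by (simp add: algebra_simps)
  then have 1: "real b * frac ?z < real d + 1" using B by simp
  have "?B * real d \<le> ?B * (real b * frac ?z)"
    using Cons.prems(4) by (simp add: algebra_simps)
  then have 2: "real d \<le> real b * frac ?z" using B by simp
  have eq: "real (b ^ Suc i) * x = of_int (int b * \<lfloor>?z\<rfloor> + int d) + (real b * frac ?z - d)"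
    by (simp add: frac_def algebra_simps)
  have fl: "\<lfloor>real (b ^ Suc i) * x\<rfloor> = int b * \<lfloor>?z\<rfloor> + int d"
    using 1 2 unfolding eq by (intro floor_unique) simp_all
  then have fr: "frac (real (b ^ Suc i) * x) = real b * frac ?z - d"
    using eq unfolding frac_def by simp
  have "\<lfloor>?z\<rfloor> \<ge> 0" using Cons.prems(2) by simp
  then obtain m where "\<lfloor>?z\<rfloor> = int m" using nonneg_int_cases by blast
  then have "nat \<lfloor>x * real b ^ Suc i\<rfloor> = b * m + d"
    using fl by (simp add: mult.commute nat_add_distrib nat_mult_distrib)
  \<comment> \<open>Here \<open>x < 1\<close> rules out the special case in \<open>digit\<close>,
    and the reduction modulo \<open>b\<close> removes \<open>b * m\<close>.\<close>
  then have "digit b x i = d"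
    using Cons.prems(3) d unfolding digit_def by simp
  moreover have "occurs_at w (digit b x) (Suc i)"
    using Cons.prems by (intro Cons.IH w) (unfold fr, simp_all add: algebra_simps)
  ultimately show ?case by (simp add: occurs_at_Cons)
qed

text \<open>The hats at the integers form a partition of unity: only those at the floor of
  \<open>y\<close> and its successor can be nonzero, and these two add up to 1.\<close>

lemma sum_hat_le_1:
  fixes y :: real
  assumes "y \<ge> 0" and fin: "finite K"
  shows "(\<Sum>k\<in>K. max 0 (1 - \<bar>y - real k\<bar>)) \<le> 1"
proof -
  define m where "m = nat \<lfloor>y\<rfloor>"
  have m: "real m \<le> y" "y < real m + 1" unfolding m_def using assms(1) by linarith+
  have "(\<Sum>k\<in>K. max 0 (1 - \<bar>y - real k\<bar>)) = (\<Sum>k\<in>K \<inter> {m, Suc m}. max 0 (1 - \<bar>y - real k\<bar>))"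
  proof (intro sum.mono_neutral_right fin ballI)
    fix k assume "k \<in> K - K \<inter> {m, Suc m}"
    then have "k < m \<or> k > Suc m" by auto
    then have "real k + 1 \<le> real m \<or> real k \<ge> real m + 2" by linarith
    then show "max 0 (1 - \<bar>y - real k\<bar>) = 0" using m by linarith
  qed auto
  also have "\<dots> \<le> (\<Sum>k\<in>{m, Suc m}. max 0 (1 - \<bar>y - real k\<bar>))"
    by (intro sum_mono2) auto
  also have "\<dots> = 1" using m by simp
  finally show ?thesis .
qed

text \<open>The peaks are the interior points of the grid of mesh \<open>1 / (B * q)\<close> in the
  cell, so the tents vanish outside it.\<close>

lemma sum_tent_le_cell:
  assumes q: "q > 0"
  shows "(\<Sum>k\<in>{v * q + 1..<(v + 1) * q}. tent (B * q) k z)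
    \<le> of_bool (real v \<le> real B * frac z \<and> real B * frac z < real v + 1)"
proof (cases "real v \<le> real B * frac z \<and> real B * frac z < real v + 1")
  case True
  then show ?thesis
    using sum_hat_le_1[of "real (B * q) * frac z" "{v * q + 1..<(v + 1) * q}"] by (simp add: tent_def)
next
  case False
  have "tent (B * q) k z = 0" if "k \<in> {v * q + 1..<(v + 1) * q}" for k
  proof -
    have k: "real v * q + 1 \<le> real k" "real k + 1 \<le> (real v + 1) * q"
      using that of_nat_mono[of "v * q + 1" k, where 'a = real]
        of_nat_mono[of "k + 1" "(v + 1) * q", where 'a = real] by (auto simp: algebra_simps)
    have "real (B * q) * frac z \<le> real v * q \<or> real (B * q) * frac z \<ge> (real v + 1) * q"
      using False mult_right_mono[of "real B * frac z" "real v" q]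
        mult_right_mono[of "real v + 1" "real B * frac z" q]
      by (simp add: mult_ac not_le not_less) linarith
    then show ?thesis using k unfolding tent_def by linarith
  qed
  then show ?thesis by simp
qed

text \<open>If all the other values are at least \<open>1 / card W - d\<close>, the total leaves at
  most \<open>1 / card W + (card W - 1) * d\<close> for the value at \<open>w\<close>.\<close>

lemma tendsto_if_lower_bounds:
  fixes f :: "'w \<Rightarrow> nat \<Rightarrow> real"
  assumes W: "finite W" "w \<in> W"
    and lower: "\<And>w e. w \<in> W \<Longrightarrow> e > 0 \<Longrightarrow> \<forall>\<^sub>F n in sequentially. f w n \<ge> 1 / card W - e"
    and total: "\<And>n. (\<Sum>w\<in>W. f w n) \<le> 1"
  shows "f w \<longlonglongrightarrow> 1 / card W"
proof (rule tendstoI)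
  fix e :: real assume e: "e > 0"
  have c: "card W > 0" using W by (auto simp: card_gt_0_iff)
  define d where "d = e / (2 * card W)"
  have d: "d > 0" using e c by (simp add: d_def)
  have de: "card W * d < e" "d < e"
    using e c mult_left_mono[of 1 "real (card W)" d] d by (auto simp: d_def field_simps)
  have "\<forall>\<^sub>F n in sequentially. \<forall>w\<in>W. f w n \<ge> 1 / card W - d"
    using W(1) lower[OF _ d] by (simp add: eventually_ball_finite_distrib)
  then show "\<forall>\<^sub>F n in sequentially. dist (f w n) (1 / card W) < e"
  proof eventually_elim
    case (elim n)
    have "f w n + (\<Sum>w\<in>W - {w}. f w n) \<le> 1"
      using total[of n] sum.remove[OF W, of "\<lambda>w. f w n"] by simp
    moreover have "(\<Sum>w\<in>W - {w}. f w n) \<ge> (\<Sum>w\<in>W - {w}. 1 / card W - d)"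
      using elim by (intro sum_mono) auto
    moreover have "(\<Sum>w\<in>W - {w}. 1 / card W - d) = (card W - 1) * (1 / card W - d)"
      using W c by (simp add: of_nat_diff)
    moreover have "(card W - 1) * (1 / card W - d) = 1 - card W * d - (1 / card W - d)"
      using c by (simp add: field_simps)
    ultimately have "f w n \<le> card W * d + (1 / card W - d)" by linarith
    moreover have "f w n \<ge> 1 / card W - d" using elim W(2) by blast
    ultimately show ?case using de d by (simp add: dist_real_def abs_less_iff)
  qed
qed

lemma absolutely_normal_if_deviation_le:
  assumes x: "0 \<le> x" "x < 1"
    and dev: "\<And>b N k t. s \<le> t \<Longrightarrow> b < t \<Longrightarrow> N < t \<Longrightarrow> 2 \<le> b \<Longrightarrow> 0 < k \<Longrightarrow> k < N \<Longrightarrow>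
      \<bar>deviation b N k (block b t) x\<bar> \<le> 3 * real t ^ 6"
  shows "absolutely_normal x"
  unfolding absolutely_normal_def
proof (intro conjI allI impI)
  show "x \<in> {0..1}" using x by simp
  fix b :: nat and w :: "nat list" assume b: "2 \<le> b" and "set w \<subseteq> {..<b}"
  define W where "W = {u. set u \<subseteq> {..<b} \<and> length u = length w}"
  define f where "f u n = real (card {i. i < n \<and> occurs_at u (digit b x) i}) / real n" for u n
  have W: "finite W" "card W = b ^ length w"
    unfolding W_def using finite_lists_length_eq[of "{..<b}"] card_lists_length_eq[of "{..<b}"] by auto
  have "f w \<longlonglongrightarrow> 1 / card W"
  proof (rule tendsto_if_lower_bounds[OF W(1)])
    show "w \<in> W" using \<open>set w \<subseteq> {..<b}\<close> by (simp add: W_def)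
  next
    fix n
    show "(\<Sum>u\<in>W. f u n) \<le> 1"
    proof -
      have "(\<Sum>u\<in>W. card {i. i < n \<and> occurs_at u (digit b x) i})
          = card (\<Union>u\<in>W. {i. i < n \<and> occurs_at u (digit b x) i})"
      proof (rule card_UN_disjoint[symmetric])
        have "u = u'" if "u \<in> W" "u' \<in> W" "occurs_at u g i" "occurs_at u' g i" for u u' g i
          \<comment> \<open>Distinct words of equal length cannot occur at the same
            position.\<close>
          using that by (auto simp: W_def occurs_at_def intro!: nth_equalityI)
        then show "\<forall>u\<in>W. \<forall>u'\<in>W. u \<noteq> u' \<longrightarrow> {i. i < n \<and> occurs_at u (digit b x) i} \<inter>
            {i. i < n \<and> occurs_at u' (digit b x) i} = {}" by blast
      qed (use W in auto)
      also have "\<dots> \<le> card {..<n}" by (rule card_mono) auto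
      finally have "real (\<Sum>u\<in>W. card {i. i < n \<and> occurs_at u (digit b x) i}) \<le> real n"
        unfolding of_nat_le_iff by simp
      then have "(\<Sum>u\<in>W. real (card {i. i < n \<and> occurs_at u (digit b x) i})) \<le> real n"
        by (simp only: of_nat_sum)
      then show ?thesis
        by (cases "n = 0") (simp_all add: f_def flip: sum_divide_distrib)
    qed
  next
    fix u and e :: real assume u: "u \<in> W" and e: "e > 0"
    \<comment> \<open>The \<open>q - 1\<close> tents inside a cell have total mean
      \<open>(q - 1) / (B * q)\<close>, which falls short of \<open>1 / B\<close> by
      \<open>1 / (B * q)\<close>; \<open>q\<close> is chosen to make this less than
      \<open>e\<close>.\<close>
    obtain p where p: "1 / real (Suc p) < e / 2" using e nat_approx_posE[of "e / 2"] by auto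
    define q where "q = Suc p"
    define v where "v = word_value b u"
    define B where "B = b ^ length w"
    define K where "K = {v * q + 1..<(v + 1) * q}"
    have u': "set u \<subseteq> {..<b}" "length u = length w" using u by (auto simp: W_def)
    have vB: "v + 1 \<le> B" using word_value_less[OF u'(1)] u'(2) by (simp add: v_def B_def)
    have k: "0 < k" "k < B * q" if "k \<in> K" for k
    proof -
      have "k < (v + 1) * q" using that by (simp add: K_def)
      also have "\<dots> \<le> B * q" using vB by (rule mult_right_mono) simp
      finally show "k < B * q" .
    qed (use that in \<open>simp add: K_def\<close>)
    have "(\<lambda>n. \<Sum>k\<in>K. (\<Sum>i<n. tent (B * q) k (real (b ^ i) * x)) / n) \<longlonglongrightarrow> (\<Sum>k\<in>K. 1 / real (B * q))"
    \<comment> \<open>From this level on, both the base \<open>b\<close> and the mesh parameter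
      \<open>B * q\<close> are among the tested parameters.\<close>
    proof (intro tendsto_sum tent_average_tendsto[where s = "s + b + B * q + 1"] b k)
      fix k t assume "k \<in> K" "t \<ge> s + b + B * q + 1"
      then show "\<bar>deviation b (B * q) k (block b t) x\<bar> \<le> 3 * real t ^ 6"
        using k[of k] b by (intro dev) auto
    qed
    moreover have "(\<Sum>k\<in>K. 1 / real (B * q)) > 1 / B - e"
    proof -
      have pos: "real B \<ge> 1" "real q > 0" using vB by (simp_all add: q_def)
      have "(\<Sum>k\<in>K. 1 / real (B * q)) = (real q - 1) / (B * q)"
        by (simp add: K_def q_def)
      also have "\<dots> = 1 / B - 1 / q / B" using pos by (simp add: field_simps)
      finally have "(\<Sum>k\<in>K. 1 / real (B * q)) = 1 / B - 1 / q / B" .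
      moreover have "1 / q / B \<le> 1 / q"
        using divide_left_mono[of 1 "real B" "1 / real q"] pos by simp
      moreover have "1 / q < e" using p e unfolding q_def by linarith
      ultimately show ?thesis by linarith
    qed
    ultimately have "\<forall>\<^sub>F n in sequentially.
        (\<Sum>k\<in>K. (\<Sum>i<n. tent (B * q) k (real (b ^ i) * x)) / n) > 1 / B - e"
      by (rule order_tendstoD)
    then show "\<forall>\<^sub>F n in sequentially. f u n \<ge> 1 / card W - e"
    proof eventually_elim
      case (elim n)
      have "(\<Sum>k\<in>K. (\<Sum>i<n. tent (B * q) k (real (b ^ i) * x)) / n)
          = (\<Sum>i<n. \<Sum>k\<in>K. tent (B * q) k (real (b ^ i) * x)) / n"
        by (subst sum.swap) (simp flip: sum_divide_distrib)
      also have "\<dots> \<le> (\<Sum>i<n. of_bool (occurs_at u (digit b x) i)) / n"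
      proof (intro divide_right_mono sum_mono)
        fix i
        have "(\<Sum>k\<in>K. tent (B * q) k (real (b ^ i) * x))
            \<le> of_bool (real v \<le> real B * frac (real (b ^ i) * x) \<and> real B * frac (real (b ^ i) * x) < real v + 1)"
          unfolding K_def by (rule sum_tent_le_cell) (simp add: q_def)
        also have "\<dots> \<le> of_bool (occurs_at u (digit b x) i)"
          using occurs_at_if_in_cell[OF u'(1) x, of i] u'(2) by (auto simp: v_def B_def)
        finally show "(\<Sum>k\<in>K. tent (B * q) k (real (b ^ i) * x)) \<le> of_bool (occurs_at u (digit b x) i)" .
      qed simp
      also have "\<dots> = f u n"
        by (simp add: f_def Int_def)
      finally show ?case using elim W(2) by (simp add: B_def)
    qed
  qed
  then show "(\<lambda>n. real (card {i. i < n \<and> occurs_at w (digit b x) i}) / real n)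
      \<longlonglongrightarrow> 1 / real b ^ length w"
    by (simp add: f_def[abs_def] W(2))
qed

theorem theorem6:
  shows "closure {x :: real. x \<in> {0..1} \<and> computable_real x \<and> absolutely_normal x} = {0..1}"
proof
  let ?S = "{x :: real. x \<in> {0..1} \<and> computable_real x \<and> absolutely_normal x}"
  show "closure ?S \<subseteq> {0..1}" by (rule closure_minimal) auto
  \<comment> \<open>Approximating interior points suffices, since the closure of the open interval
    is the closed one.\<close>
  have "{0<..<1} \<subseteq> closure ?S"
  proof
    fix y :: real assume "y \<in> {0<..<1}"
    then have y: "0 < y" "y < 1" by auto
    show "y \<in> closure ?S"
      unfolding closure_approachable
    proof (intro allI impI)
      fix e :: real assume e: "e > 0"
      \<comment> \<open>An interval this short around \<open>y\<close> stays within distance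
        \<open>e\<close> of \<open>y\<close> and below 1, as the digit argument requires
        \<open>x < 1\<close>.\<close>
      obtain m where m: "(1/2) ^ m < min e (1 - y)"
        using real_arch_pow_inv[of "min e (1 - y)" "1/2"] e y by auto
      define s where "s = max 10000 m"
      have s: "s \<ge> 10000" "m \<le> s" by (simp_all add: s_def)
      have "s \<le> s ^ 8" using s(1) by (intro self_le_power) auto
      define P :: real where "P = 2 ^ s ^ 8"
      have P: "P > 0" by (simp add: P_def)
      have "(1/2 :: real) ^ s ^ 8 \<le> (1/2) ^ m"
        using s(2) \<open>s \<le> s ^ 8\<close> by (intro power_decreasing) auto
      with m have small: "1 / P < e" "1 / P < 1 - y" by (simp_all add: P_def power_one_over)
      \<comment> \<open>The descent starts from the dyadic interval of level \<open>s\<close> that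
        contains \<open>y\<close>.\<close>
      define a where "a = nat \<lfloor>y * P\<rfloor>"
      have "0 \<le> y * P" using y P by simp
      then have "real a \<le> y * P" "y * P \<le> real a + 1" unfolding a_def by linarith+
      then have a: "real a / P \<le> y" "y \<le> real a / P + 1 / P"
        using P by (simp_all add: field_simps)
      obtain x where
        lower: "\<And>n. real (descent s a n) / 2 ^ (s + n) ^ 8 \<le> x" and
        upper: "\<And>n. x \<le> real (descent s a n) / 2 ^ (s + n) ^ 8 + 1 / 2 ^ (s + n) ^ 8"
        by (rule descent_limit[OF s(1), of a]) blast
      have x: "real a / P \<le> x" "x \<le> real a / P + 1 / P"
        using lower[of 0] upper[of 0] by (simp_all add: P_def)
      have "0 \<le> real a / P" using P by simp
      with x a small have x01: "0 \<le> x" "x < 1" and xy: "\<bar>x - y\<bar> < e" by linarith+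
      have "absolutely_normal x"
        using x01 descent_deviation[OF s(1) lower upper]
        by (intro absolutely_normal_if_deviation_le)
      moreover have "computable_real x" by (rule descent_computable[OF lower upper])
      ultimately show "\<exists>x\<in>?S. dist x y < e"
        using x01 xy by (intro bexI[of _ x]) (auto simp: dist_real_def)
    qed
  qed
  then have "closure {0<..<1} \<subseteq> closure ?S" by (rule closure_minimal) simp
  then show "{0..1} \<subseteq> closure ?S" by simp
qed

end
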